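(* Let $\mathbf u^*\in\mathbb R^n$ be an accumulation point of the sequence of iterates $\{\mathbf u^{(j)}\}_j$ produced by Algorithm $\mathtt{modBSSN}$ (defined in the context, with any starting vector $\mathbf u^{(0)}\in\mathbb R^n$ and parameters $\beta\in(0,1)$, $\sigma\in(0,\tfrac12)$). Then $\Theta(\mathbf u^* )=0$.
   Context: **Problem data and standing assumptions.** Let $n\in\mathbb N$, $g\colon\mathbb R^n\to\mathbb R$ strictly convex, $w_1,\dots,w_n>0$ weights, and $\gamma>0$ fixed. Define $\mathbf F\colon\mathbb R^n\to\mathbb R^n$ by $\mathbf F(\mathbf u):=\mathbf u-\mathbf S_{\gamma\mathbf w}(\mathbf u-\gamma\nabla g(\mathbf u))$, where $\mathbf S_{\boldsymbol\beta}(\mathbf u):=(\operatorname{sgn}(u_k)\max\{|u_k|-\beta_k,0\})_k$ is componentwise soft thresholding, and define $\Theta(\mathbf u):=\|\mathbf F(\mathbf u)\|_2^2$. Standing assumptions: (A1) $g$ is twice Lipschitz-continuously differentiable (twice differentiable with Lipschitz continuous Hessian), $\nabla^2 g(\mathbf u)$ is positive definite for all $\mathbf u\in\mathbb R^n$, and there exist constants $0<c_1,c_2<\infty$ with $c_1\|\mathbf h\|_2^2\le\langle\nabla^2g(\mathbf u)\mathbf h,\mathbf h\rangle\le c_2\|\mathbf h\|_2^2$ for all $\mathbf h,\mathbf u\in\mathbb R^n$. (A2) The level sets $\{\mathbf u\in\mathbb R^n:\Theta(\mathbf u)\le\Theta(\mathbf u^{(0)})\}$, $\mathbf u^{(0)}\in\mathbb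 R^n$, are compact. **Index sets.** For $\mathbf u\in\mathbb R^n$ write $p_k:=\gamma(\nabla g(\mathbf u))_k+\gamma w_k$ and $m_k:=\gamma(\nabla g(\mathbf u))_k-\gamma w_k$, and define (argument $\mathbf u$ dropped) $\mathcal A^+:=\{k:p_k<u_k\}$, $\mathcal A^-:=\{k:u_k<m_k\}$, $\mathcal I^\circ:=\{k:m_k<u_k<p_k\}$, $\mathcal I^+:=\{k:u_k=p_k\}$, $\mathcal I^-:=\{k:u_k=m_k\}$; $\mathcal A^+_+:=\{k:p_k<u_k<0\}$, $\mathcal A^-_-:=\{k:0<u_k<m_k\}$, $\mathcal I^\circ_+:=\{k:m_k<u_k<p_k<0\}$, $\mathcal I^\circ_-:=\{k:0<m_k<u_k<p_k\}$. The modified index sets are $\overline{\mathcal A^+}:=\mathcal A^+\setminus\mathcal A^+_+$, $\overline{\mathcal A^-}:=\mathcal A^-\setminus\mathcal A^-_-$, $\overline{\mathcal I^\circ}:=\mathcal I^\circ\setminus(\mathcal I^\circ_+\cup\mathcal I^\circ_-)$, $\overline{\mathcal I^+}:=\mathcal I^+\cup\mathcal A^+_+\cup\mathcal I^\circ_+$, $\overline{\mathcal I^-}:=\mathcal I^-\cup\mathcal A^-_-\cup\mathcal I^\circ_-$, and $\overline{\mathcal A}:=\overline{\mathcal A^+}\cup\overline{\mathcal A^-}$, $\overline{\mathcal I}:=\overline{\mathcal I^\circ}\cup\overline{\mathcal I^+}\cup\overline{\mathcal I^-}$. **Newton direction $\mathbf d(\mathbf u)$.** Let $\mathbf M:=\nabla^2g(\mathbf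 u)$; subscripts denote subblocks/subvectors, $\mathbf M_{\overline{\mathcal A},\overline{\mathcal A}}^{-1}:=(\mathbf M_{\overline{\mathcal A},\overline{\mathcal A}})^{-1}$, and terms belonging to empty index sets are omitted. For index sets $P,Q$ put $\mathbf H_{P,Q}:=\mathbf M_{P,Q}-\mathbf M_{P,\overline{\mathcal A}}\mathbf M_{\overline{\mathcal A},\overline{\mathcal A}}^{-1}\mathbf M_{\overline{\mathcal A},Q}$. Define $$\mathbf N:=\gamma\begin{pmatrix}\mathbf H_{\overline{\mathcal I^+},\overline{\mathcal I^+}}&-\mathbf H_{\overline{\mathcal I^+},\overline{\mathcal I^-}}\\-\mathbf H_{\overline{\mathcal I^-},\overline{\mathcal I^+}}&\mathbf H_{\overline{\mathcal I^-},\overline{\mathcal I^-}}\end{pmatrix},$$ $$\mathbf z:=\begin{pmatrix}-\gamma\mathbf H_{\overline{\mathcal I^+},\overline{\mathcal I^\circ}}\mathbf u_{\overline{\mathcal I^\circ}}-\mathbf M_{\overline{\mathcal I^+},\overline{\mathcal A}}\mathbf M_{\overline{\mathcal A},\overline{\mathcal A}}^{-1}\mathbf F(\mathbf u)_{\overline{\mathcal A}}+\mathbf F(\mathbf u)_{\overline{\mathcal I^+}}\\ \gamma\mathbf H_{\overline{\mathcal I^-},\overline{\mathcal I^\circ}}\mathbf u_{\overline{\mathcal I^\circ}}+\mathbf M_{\overline{\mathcal I^-},\overline{\mathcal A}}\mathbf M_{\overline{\mathcal A},\overline{\mathcal A}}^{-1}\mathbf F(\mathbf u)_{\overline{\mathcal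 A}}-\mathbf F(\mathbf u)_{\overline{\mathcal I^-}}\end{pmatrix}-\mathbf N\begin{pmatrix}\mathbf u_{\overline{\mathcal I^+}}\\-\mathbf u_{\overline{\mathcal I^-}}\end{pmatrix}.$$ The linear complementarity problem $\mathbf x\ge\mathbf 0$, $\mathbf N\mathbf x+\mathbf z\ge\mathbf 0$, $\langle\mathbf x,\mathbf N\mathbf x+\mathbf z\rangle=0$ has a unique solution $\mathbf x=(\mathbf x_{\overline{\mathcal I^+}},\mathbf x_{\overline{\mathcal I^-}})$. Then $\mathbf d=\mathbf d(\mathbf u)\in\mathbb R^n$ is defined by $\mathbf d_{\overline{\mathcal I^\circ}}=-\mathbf u_{\overline{\mathcal I^\circ}}$, $\mathbf d_{\overline{\mathcal I^+}}=\mathbf x_{\overline{\mathcal I^+}}-\mathbf u_{\overline{\mathcal I^+}}$, $\mathbf d_{\overline{\mathcal I^-}}=-\mathbf x_{\overline{\mathcal I^-}}-\mathbf u_{\overline{\mathcal I^-}}$, $\mathbf d_{\overline{\mathcal A}}=\frac1\gamma\mathbf M_{\overline{\mathcal A},\overline{\mathcal A}}^{-1}\big(-\gamma\mathbf M_{\overline{\mathcal A},\overline{\mathcal I}}\mathbf d_{\overline{\mathcal I}}-\mathbf F(\mathbf u)_{\overline{\mathcal A}}\big)$. **Algorithm $\mathtt{modBSSN}$.** Given $\mathbf u^{(0)}\in\mathbb R^n$, $\beta\in(0,1)$, $\sigma\in(0,\frac12)$, for $j=0,1,\dots$ set $\mathbf d^{(j)}:=\mathbf d(\mathbf u^{(j)})$,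 $t_j:=\max\{\beta^l:\ l\in\{0,1,\dots\},\ \Theta(\mathbf u^{(j)}+\beta^l\mathbf d^{(j)})\le(1-2\sigma\beta^l)\Theta(\mathbf u^{(j)})\}$ (the Armijo rule; such an $l$ exists), and $\mathbf u^{(j+1)}:=\mathbf u^{(j)}+t_j\mathbf d^{(j)}$. The iteration is considered as an infinite sequence, without termination by a tolerance. *)

theory Defs
  imports "HOL-Analysis.Analysis"
begin

definition strictly_convex_on :: "'a::real_vector set \<Rightarrow> ('a \<Rightarrow> real) \<Rightarrow> bool" where
  "strictly_convex_on S f \<longleftrightarrow> convex S \<and>
     (\<forall>x\<in>S. \<forall>y\<in>S. \<forall>t. x \<noteq> y \<longrightarrow> 0 < t \<longrightarrow> t < 1 \<longrightarrow>
        f ((1 - t) *\<^sub>R x + t *\<^sub>R y) < (1 - t) * f x + t * f y)"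

(* Both are only meaningful where the derivative in question exists. *)

definition grad :: "(real^'n \<Rightarrow> real) \<Rightarrow> real^'n \<Rightarrow> real^'n" where
  "grad f u = (THE D. GDERIV f u :> D)"

definition hess :: "(real^'n \<Rightarrow> real) \<Rightarrow> real^'n \<Rightarrow> real^'n^'n" where
  "hess f u = jacobian (grad f) (at u)"

definition soft_threshold :: "real^'n \<Rightarrow> real^'n \<Rightarrow> real^'n" where
  "soft_threshold b u = (\<chi> k. sgn (u $ k) * max (\<bar>u $ k\<bar> - b $ k) 0)"


text \<open>
  The index sets vary with the iterate, so subvectors and subblocks are kept at full size and
  padded with zeros: products of padded blocks are the padded products of the subblocks, and
  blocks belonging to an empty index set vanish.
\<close>

definition subvec :: "'n set \<Rightarrow> real^'n \<Rightarrow> real^'n" where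
  "subvec P v = (\<chi> k. if k \<in> P then v $ k else 0)"

definition block :: "'n set \<Rightarrow> 'n set \<Rightarrow> real^'n^'n \<Rightarrow> real^'n^'n" where
  "block P Q M = (\<chi> i j. if i \<in> P \<and> j \<in> Q then M $ i $ j else 0)"

(* The inverse of the principal subblock on A; block A A (mat 1) is the padded identity. *)
definition block_inv :: "'n set \<Rightarrow> real^'n^'n \<Rightarrow> real^'n^'n" where
  "block_inv A M = (THE B. block A A B = B \<and>
     block A A M ** B = block A A (mat 1) \<and> B ** block A A M = block A A (mat 1))"

(* The linear complementarity problem with coordinates in J. *)
definition is_lcp_solution :: "'n set \<Rightarrow> real^'n^'n \<Rightarrow> real^'n \<Rightarrow> real^'n \<Rightarrow> bool" where
  "is_lcp_solution J N z x \<longleftrightarrow> subvec J x = x \<and>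
     (\<forall>k\<in>J. 0 \<le> x $ k) \<and> (\<forall>k\<in>J. 0 \<le> (N *v x + z) $ k) \<and> inner x (N *v x + z) = 0"


context
  fixes \<gamma> :: real and w :: "real^'n" and g :: "real^'n \<Rightarrow> real"
begin

definition resid :: "real^'n \<Rightarrow> real^'n" where
  "resid u = u - soft_threshold (\<gamma> *\<^sub>R w) (u - \<gamma> *\<^sub>R grad g u)"

definition Theta :: "real^'n \<Rightarrow> real" where
  "Theta u = (norm (resid u))\<^sup>2"

definition p_val :: "real^'n \<Rightarrow> 'n \<Rightarrow> real" where
  "p_val u k = \<gamma> * grad g u $ k + \<gamma> * w $ k"

definition m_val :: "real^'n \<Rightarrow> 'n \<Rightarrow> real" where
  "m_val u k = \<gamma> * grad g u $ k - \<gamma> * w $ k"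

definition Ap :: "real^'n \<Rightarrow> 'n set" where
  "Ap u = {k. p_val u k < u $ k}"

definition Am :: "real^'n \<Rightarrow> 'n set" where
  "Am u = {k. u $ k < m_val u k}"

definition Io :: "real^'n \<Rightarrow> 'n set" where
  "Io u = {k. m_val u k < u $ k \<and> u $ k < p_val u k}"

definition Ip :: "real^'n \<Rightarrow> 'n set" where
  "Ip u = {k. u $ k = p_val u k}"

definition Im :: "real^'n \<Rightarrow> 'n set" where
  "Im u = {k. u $ k = m_val u k}"

definition Ap_p :: "real^'n \<Rightarrow> 'n set" where
  "Ap_p u = {k. p_val u k < u $ k \<and> u $ k < 0}"

definition Am_m :: "real^'n \<Rightarrow> 'n set" where
  "Am_m u = {k. 0 < u $ k \<and> u $ k < m_val u k}"

definition Io_p :: "real^'n \<Rightarrow> 'n set" where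
  "Io_p u = {k. m_val u k < u $ k \<and> u $ k < p_val u k \<and> p_val u k < 0}"

definition Io_m :: "real^'n \<Rightarrow> 'n set" where
  "Io_m u = {k. 0 < m_val u k \<and> m_val u k < u $ k \<and> u $ k < p_val u k}"

definition Ap_bar :: "real^'n \<Rightarrow> 'n set" where
  "Ap_bar u = Ap u - Ap_p u"

definition Am_bar :: "real^'n \<Rightarrow> 'n set" where
  "Am_bar u = Am u - Am_m u"

definition Io_bar :: "real^'n \<Rightarrow> 'n set" where
  "Io_bar u = Io u - (Io_p u \<union> Io_m u)"

definition Ip_bar :: "real^'n \<Rightarrow> 'n set" where
  "Ip_bar u = Ip u \<union> Ap_p u \<union> Io_p u"

definition Im_bar :: "real^'n \<Rightarrow> 'n set" where
  "Im_bar u = Im u \<union> Am_m u \<union> Io_m u"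

definition A_bar :: "real^'n \<Rightarrow> 'n set" where
  "A_bar u = Ap_bar u \<union> Am_bar u"

definition I_bar :: "real^'n \<Rightarrow> 'n set" where
  "I_bar u = Io_bar u \<union> Ip_bar u \<union> Im_bar u"

definition Hblock :: "real^'n \<Rightarrow> 'n set \<Rightarrow> 'n set \<Rightarrow> real^'n^'n" where
  "Hblock u P Q = (let M = hess g u; A = A_bar u in
     block P Q M - block P A M ** block_inv A M ** block A Q M)"

text \<open>
  For positive \<open>\<gamma>\<close> and \<open>w\<close> the sets \<open>Ip_bar u\<close> and \<open>Im_bar u\<close> are disjoint. The
  two-by-two block system of the complementarity problem is therefore stored on the index set
  \<open>Ip_bar u \<union> Im_bar u\<close>, each sum below being the sum of the zero-padded blocks.
\<close>

definition lcp_N :: "real^'n \<Rightarrow> real^'n^'n" where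
  "lcp_N u = (let P = Ip_bar u; Q = Im_bar u in
     \<gamma> *\<^sub>R ((Hblock u P P - Hblock u P Q) + (- Hblock u Q P + Hblock u Q Q)))"

definition lcp_z :: "real^'n \<Rightarrow> real^'n" where
  "lcp_z u = (let M = hess g u; A = A_bar u; B = block_inv A M;
       Z = Io_bar u; P = Ip_bar u; Q = Im_bar u; F = resid u in
     (- (\<gamma> *\<^sub>R (Hblock u P Z *v subvec Z u)) - (block P A M ** B) *v subvec A F + subvec P F)
     + (\<gamma> *\<^sub>R (Hblock u Q Z *v subvec Z u) + (block Q A M ** B) *v subvec A F - subvec Q F)
     - lcp_N u *v (subvec P u - subvec Q u))"

definition lcp_x :: "real^'n \<Rightarrow> real^'n" where
  "lcp_x u = (THE x. is_lcp_solution (Ip_bar u \<union> Im_bar u) (lcp_N u) (lcp_z u) x)"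

definition newton_dir_I :: "real^'n \<Rightarrow> real^'n" where
  "newton_dir_I u = (let P = Ip_bar u; Q = Im_bar u; x = lcp_x u in
     - subvec (Io_bar u) u + (subvec P x - subvec P u) + (- subvec Q x - subvec Q u))"

definition newton_dir_A :: "real^'n \<Rightarrow> real^'n" where
  "newton_dir_A u = (let M = hess g u; A = A_bar u in
     (1 / \<gamma>) *\<^sub>R (block_inv A M *v
       (- (\<gamma> *\<^sub>R (block A (I_bar u) M *v newton_dir_I u)) - subvec A (resid u))))"

definition newton_dir :: "real^'n \<Rightarrow> real^'n" where
  "newton_dir u = newton_dir_I u + newton_dir_A u"

definition armijo_step :: "real \<Rightarrow> real \<Rightarrow> real^'n \<Rightarrow> real" where
  "armijo_step \<beta> \<sigma> u = (GREATEST t. \<exists>l::nat. t = \<beta> ^ l \<and>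
     Theta (u + \<beta> ^ l *\<^sub>R newton_dir u) \<le> (1 - 2 * \<sigma> * \<beta> ^ l) * Theta u)"

primrec modBSSN :: "real \<Rightarrow> real \<Rightarrow> real^'n \<Rightarrow> nat \<Rightarrow> real^'n" where
  "modBSSN \<beta> \<sigma> u0 0 = u0"
| "modBSSN \<beta> \<sigma> u0 (Suc j) = modBSSN \<beta> \<sigma> u0 j +
     armijo_step \<beta> \<sigma> (modBSSN \<beta> \<sigma> u0 j) *\<^sub>R newton_dir (modBSSN \<beta> \<sigma> u0 j)"

end

end

theory Submission
  imports Defs
begin

text \<open>
  Write \<open>m\<close>, \<open>p\<close> for the vectors \<open>\<gamma> \<nabla>g(u) \<mp> \<gamma> w\<close> and \<open>M\<close> for the Hessian of \<open>g\<close> at \<open>u\<close>. Soft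
  thresholding subtracts from its argument the projection onto a box, so each coordinate of the
  residual \<open>F(u)\<close> is the median of \<open>m\<^sub>k\<close>, \<open>u\<^sub>k\<close> and \<open>p\<^sub>k\<close> (\<open>resid_eq_mid\<close>). By the definition of
  \<open>d = d(u)\<close>, coordinatewise either \<open>u + d\<close> vanishes, or \<open>F + \<gamma> M d\<close> vanishes, or the two numbers
  are complementary with a sign that depends on the index set (\<open>newton_complementarity\<close>); the
  linear complementarity problem behind this has a unique solution because a Schur complement
  inherits coercivity (\<open>schur_coercive\<close>, \<open>ex1_lcp_solution\<close>).

  The modified index sets are chosen such that these relations push every coordinate of \<open>F\<close>
  towards zero, with an error that is quadratic in the step size: if \<open>F\<^sub>k(u) < 0\<close>, then
  \<open>F\<^sub>k(u + s d) \<ge> (1 - s) F\<^sub>k(u) - O(s\<^sup>2)\<close>, and symmetrically for \<open>F\<^sub>k(u) > 0\<close>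
  (\<open>mid_step_lower\<close>). In the smooth regions this follows by linearization. Near a kink the
  median is a minimum or a maximum of two functions, and the sign conditions bound the one that
  counts. The estimate needs \<open>s\<close> to be small compared with \<open>\<bar>F\<^sub>k(u)\<bar>\<close> and with the gap
  \<open>p\<^sub>k - m\<^sub>k = 2 \<gamma> w\<^sub>k\<close>, but it does not depend on how close \<open>u\<close> is to a kink. Coordinates with
  a small residual contribute little to \<open>\<Theta>\<close>, whatever happens to them, because \<open>F\<close> is Lipschitz
  along the step. Hence, on a bounded set on which \<open>\<Theta> \<ge> \<theta> > 0\<close>, the Armijo inequality holds for
  all step sizes up to one common \<open>\<tau> > 0\<close> (\<open>uniform_sufficient_decrease\<close>). The constants are
  uniform because testing the Newton system with \<open>d\<close> bounds \<open>d\<close> on bounded sets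
  (\<open>d_quadratic_bound\<close>).

  Consequently \<open>\<Theta>\<close> decreases along the iteration, and backtracking never selects less than
  \<open>\<beta> \<tau>\<close> at a point of such a set (\<open>armijo_decrease\<close>). If \<open>\<theta> = \<Theta>(u*) > 0\<close> at an accumulation point
  \<open>u*\<close>, then \<open>\<Theta> \<ge> \<theta>\<close> at every iterate, and the steps taken at the iterates of a subsequence that
  converges to \<open>u*\<close> all multiply \<open>\<Theta>\<close> by at most one fixed factor \<open>q < 1\<close>. In the limit
  \<open>\<theta> \<le> q \<theta>\<close>, which is absurd.
\<close>

section \<open>Padded blocks and Schur complements of coercive matrices\<close>

lemma subvec_simps [simp]:
  fixes P Q :: "'n::finite set"
  shows "subvec P (subvec Q v) = subvec (P \<inter> Q) v"
    and "subvec P (0 :: real^'n) = 0"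
    and "subvec {} v = 0"
  by (simp_all add: subvec_def vec_eq_iff)

lemma subvec_nth: "subvec P v $ k = (if k \<in> P then v $ k else 0)"
  by (simp add: subvec_def)

lemma subvec_eq_self_iff: "subvec P v = v \<longleftrightarrow> (\<forall>k. k \<notin> P \<longrightarrow> v $ k = 0)"
  by (auto simp: vec_eq_iff subvec_nth)

lemma subvec_eq_0_iff: "subvec P v = 0 \<longleftrightarrow> (\<forall>k\<in>P. v $ k = 0)"
  by (auto simp: vec_eq_iff subvec_nth)

lemma subvec_linear:
  "subvec P (u + v) = subvec P u + subvec P v"
  "subvec P (u - v) = subvec P u - subvec P v"
  "subvec P (- u) = - subvec P u"
  "subvec P (r *\<^sub>R u) = r *\<^sub>R subvec P u"
  by (simp_all add: subvec_def vec_eq_iff)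

text \<open>
  Padded blocks act on vectors as a restriction, followed by the full matrix, followed by a
  restriction. All matrix identities below are therefore checked on vectors.
\<close>
lemma block_mult_vec: "block P Q M *v v = subvec P (M *v subvec Q v)"
  by (simp add: vec_eq_iff subvec_def block_def matrix_vector_mult_def if_distrib
      cong: if_cong) (auto intro!: sum.cong)

lemma block_eq_iff: "block A A B = B \<longleftrightarrow> (\<forall>v. B *v v = subvec A (B *v subvec A v))"
  unfolding matrix_eq block_mult_vec by (simp only: eq_commute)

lemma minus_matrix_vector_mult: "(- M) *v v = - (M *v v)" for M :: "real^'n^'m"
  by (simp add: vec_eq_iff matrix_vector_mult_def sum_negf)

lemma matrix_vector_mult_uminus: "M *v (- v) = - (M *v v)" for M :: "real^'n^'m"
  by (simp add: vec_eq_iff matrix_vector_mult_def sum_negf)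

lemma norm_subvec_le: "norm (subvec P v) \<le> norm v"
  by (rule norm_le_componentwise_cart) (simp add: subvec_nth)

definition coercive :: "real \<Rightarrow> real^'n^'n \<Rightarrow> bool" where
  "coercive c M \<longleftrightarrow> 0 < c \<and> (\<forall>h. c * (norm h)\<^sup>2 \<le> inner (M *v h) h)"

lemma coercive_zero: "coercive c M \<Longrightarrow> inner (M *v h) h \<le> 0 \<Longrightarrow> h = 0"
  unfolding coercive_def
  by (metis linorder_not_le mult_pos_pos order.trans zero_less_norm_iff zero_less_power)

text \<open>
  The principal subblock is completed to the block diagonal matrix \<open>M'\<close> that is the identity off
  \<open>A\<close>. Coercivity makes \<open>M'\<close> injective, and the \<open>A\<close>-block of its inverse is the padded inverse.
\<close>
lemma ex1_block_inv:
  fixes M :: "real^'n^'n"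
  assumes M: "coercive c M"
  shows "\<exists>!B. block A A B = B \<and>
     block A A M ** B = block A A (mat 1) \<and> B ** block A A M = block A A (mat 1)"
proof -
  define M' where "M' = block A A M + block (- A) (- A) (mat 1)"
  have M': "M' *v x = subvec A (M *v subvec A x) + subvec (- A) x" for x
    by (simp add: M'_def algebra_simps block_mult_vec)
  have "x = 0" if "M' *v x = 0" for x
  proof -
    have 1: "subvec A (M *v subvec A x) = 0"
      using arg_cong[OF that, of "subvec A"] by (simp add: M' subvec_linear)
    have 2: "subvec (- A) x = 0"
      using arg_cong[OF that, of "subvec (- A)"] by (simp add: M' subvec_linear)
    have "inner (M *v subvec A x) (subvec A x) = inner (subvec A (M *v subvec A x)) (subvec A x)"
      by (auto simp: inner_vec_def subvec_nth intro!: sum.cong)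
    then have "subvec A x = 0"
      using 1 coercive_zero[OF M] by simp
    with 2 have "x $ i = 0" for i
      unfolding subvec_eq_0_iff by (cases "i \<in> A") simp_all
    then show "x = 0"
      by (simp add: vec_eq_iff)
  qed
  then have "invertible M'"
    by (metis invertible_left_inverse matrix_left_invertible_ker)
  then obtain W where W: "M' ** W = mat 1" "W ** M' = mat 1"
    unfolding invertible_def by auto
  define B where "B = block A A W"
  have B0: "block A A B = B"
    by (simp add: B_def vec_eq_iff block_def)
  have B1: "block A A M ** B = block A A (mat 1)"
  proof -
    have "subvec A (M' *v (W *v x)) = subvec A x" for x
      by (simp add: matrix_vector_mul_assoc W)
    then have "subvec A (M *v subvec A (W *v x)) = subvec A x" for x
      by (simp add: M' subvec_linear)
    then show ?thesis
      by (simp add: B_def matrix_eq block_mult_vec flip: matrix_vector_mul_assoc)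
  qed
  have B2: "B ** block A A M = block A A (mat 1)"
  proof -
    have "W *v (M' *v subvec A x) = subvec A x" for x
      by (simp add: matrix_vector_mul_assoc W)
    moreover have "M' *v subvec A x = subvec A (M *v subvec A x)" for x
      by (simp add: M')
    ultimately have *: "W *v subvec A (M *v subvec A x) = subvec A x" for x
      by simp
    have "B *v (block A A M *v x) = block A A (mat 1) *v x" for x
      by (simp add: B_def block_mult_vec *)
    then show ?thesis
      by (simp only: matrix_eq matrix_vector_mul_assoc [symmetric]) blast
  qed
  show ?thesis
  proof (rule ex1I[of _ B])
    show "block A A B = B \<and> block A A M ** B = block A A (mat 1) \<and>
        B ** block A A M = block A A (mat 1)"
      using B0 B1 B2 by blast
  next
    fix C
    assume C: "block A A C = C \<and> block A A M ** C = block A A (mat 1) \<and>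
        C ** block A A M = block A A (mat 1)"
    then have C1: "block A A C = C" and C2: "C ** block A A M = block A A (mat 1)"
      by blast+
    have "B = block A A (mat 1) ** B"
      by (simp add: matrix_eq block_mult_vec B_def flip: matrix_vector_mul_assoc)
    also have "\<dots> = C ** (block A A M ** B)"
      by (simp only: C2 matrix_mul_assoc)
    also have "\<dots> = C ** block A A (mat 1)"
      by (simp only: B1)
    also have "\<dots> = block A A C ** block A A (mat 1)"
      by (simp only: C1)
    also have "\<dots> = block A A C"
      by (simp add: matrix_eq block_mult_vec flip: matrix_vector_mul_assoc)
    finally show "C = B"
      by (simp only: C1)
  qed
qed

lemma block_inv:
  fixes M :: "real^'n^'n" and A :: "'n set"
  assumes M: "coercive c M"
  defines "B \<equiv> block_inv A M"
  shows subvec_block_inv: "subvec A (B *v v) = B *v v"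
    and block_inv_subvec: "B *v subvec A v = B *v v"
    and block_inv_right: "subvec A (M *v (B *v v)) = subvec A v"
proof -
  have B: "block A A B = B \<and> block A A M ** B = block A A (mat 1)"
    using theI'[OF ex1_block_inv[OF M, of A]] by (simp add: B_def block_inv_def)
  then have *: "B *v x = subvec A (B *v subvec A x)" for x
    using block_eq_iff by blast
  show 1: "subvec A (B *v v) = B *v v" for v
    unfolding *[of v] by simp
  show "B *v subvec A v = B *v v"
    unfolding *[of v] *[of "subvec A v"] by simp
  have "(block A A M ** B) *v v = block A A (mat 1) *v v"
    using B by simp
  then show "subvec A (M *v (B *v v)) = subvec A v"
    by (simp add: block_mult_vec 1 flip: matrix_vector_mul_assoc)
qed

text \<open>
  The subblocks of the full-size map \<open>M - M B M\<close>, with \<open>B\<close> the padded inverse of the block on \<open>A\<close>,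
  are the blocks \<open>H\<close> of the Newton system; keeping the map at full size makes it linear in one
  argument and free of index sets other than \<open>A\<close>.
\<close>
definition schur :: "'n set \<Rightarrow> real^'n^'n \<Rightarrow> real^'n \<Rightarrow> real^'n" where
  "schur A M v = M *v v - M *v (block_inv A M *v (M *v v))"

lemma schur_linear:
  "schur A M (u + v) = schur A M u + schur A M v"
  "schur A M (u - v) = schur A M u - schur A M v"
  "schur A M (- v) = - schur A M v"
  "schur A M (r *\<^sub>R v) = r *\<^sub>R schur A M v"
  by (simp_all add: schur_def algebra_simps matrix_vector_mult_uminus)

text \<open>
  The quadratic form of the Schur complement at \<open>y\<close> is the quadratic form of \<open>M\<close> at \<open>y - q\<close>, where
  \<open>q = B M y\<close> eliminates the \<open>A\<close>-coordinates. As \<open>q\<close> lives on \<open>A\<close> and \<open>y\<close> off \<open>A\<close>, subtracting \<open>q\<close>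
  can only increase the norm, so the constant is not lost.
\<close>
lemma schur_coercive:
  fixes M :: "real^'n^'n"
  assumes M: "coercive c M" and y: "subvec A y = 0"
  shows "c * (norm y)\<^sup>2 \<le> inner (schur A M y) y"
proof -
  define q where "q = block_inv A M *v (M *v y)"
  have q: "subvec A q = q"
    unfolding q_def by (rule subvec_block_inv[OF M])
  have q0: "q $ k = 0" if "k \<notin> A" for k
    using q that by (simp add: subvec_eq_self_iff)
  have y0: "y $ k = 0" if "k \<in> A" for k
    using y that by (simp add: subvec_eq_0_iff)
  have Mh: "M *v (y - q) = schur A M y"
    by (simp add: schur_def q_def algebra_simps)
  have 0: "subvec A (schur A M y) = 0"
    by (simp add: schur_def subvec_linear block_inv_right[OF M])
  have "inner (schur A M y) q = inner (subvec A (schur A M y)) q"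
    unfolding inner_vec_def by (rule sum.cong) (auto simp: subvec_nth q0)
  then have eq: "inner (M *v (y - q)) (y - q) = inner (schur A M y) y"
    by (simp add: Mh inner_diff_right 0)
  have "norm y \<le> norm (y - q)"
  proof (rule norm_le_componentwise_cart)
    show "norm (y $ i) \<le> norm ((y - q) $ i)" for i
      by (cases "i \<in> A") (simp_all add: q0 y0)
  qed
  moreover have "0 < c"
    using M by (simp only: coercive_def)
  ultimately have "c * (norm y)\<^sup>2 \<le> c * (norm (y - q))\<^sup>2"
    by (intro mult_left_mono power_mono) auto
  also have "\<dots> \<le> inner (M *v (y - q)) (y - q)"
    using M by (simp only: coercive_def)
  finally show ?thesis
    unfolding eq .
qed

section \<open>Linear complementarity problems with a coercive matrix\<close>

text \<open>
  Complementarity of two numbers as a fixed point property of a projected step.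
\<close>
lemma max_fixpoint_iff:
  fixes x y t :: real
  assumes "0 < t"
  shows "x = max 0 (x - t * y) \<longleftrightarrow> 0 \<le> x \<and> 0 \<le> y \<and> x * y = 0"
proof -
  have "0 \<le> t * y \<longleftrightarrow> 0 \<le> y" "t * y = 0 \<longleftrightarrow> y = 0" "0 < t * y \<longleftrightarrow> 0 < y"
    using assms by (auto simp: zero_le_mult_iff zero_less_mult_iff)
  then show ?thesis
    by (cases "0 \<le> x - t * y") (auto simp: max_def)
qed

lemma closed_subvec: "closed {x :: real^'n. subvec J x = x}"
proof -
  have "{x :: real^'n. subvec J x = x} = (\<Inter>k\<in>- J. {x. x $ k = 0})"
    by (auto simp: subvec_eq_self_iff)
  moreover have "closed {x :: real^'n. x $ k = 0}" for k
    by (intro closed_Collect_eq continuous_intros)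
  ultimately show ?thesis
    by auto
qed

text \<open>
  The solutions are the fixed points of the projected step
  \<open>x \<mapsto> max 0 (x - t (N x + z))\<close>, which is a contraction for small \<open>t\<close> when \<open>N\<close> is coercive, so
  that Banach's theorem gives existence and uniqueness together.
\<close>
lemma ex1_lcp_solution:
  fixes N :: "real^'n^'n"
  assumes a: "0 < a"
    and N: "\<And>x. subvec J x = x \<Longrightarrow> a * (norm x)\<^sup>2 \<le> inner (N *v x) x"
  shows "\<exists>!x. is_lcp_solution J N z x"
proof -
  obtain K0 where K0: "\<And>x. norm (N *v x) \<le> norm x * K0"
    using bounded_linear.bounded[OF matrix_vector_mul_bounded_linear[of N]] by auto
  define K where "K = max a K0"
  have K: "0 < K" "a \<le> K" using a by (auto simp: K_def)
  have KN: "norm (N *v x) \<le> K * norm x" for x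
    using K0[of x] mult_left_mono[of K0 K "norm x"] by (simp add: K_def mult.commute)
  \<comment> \<open>the step size that minimizes the contraction bound \<open>1 - 2 t a + t\<^sup>2 K\<^sup>2\<close>\<close>
  define t where "t = a / K\<^sup>2"
  have t: "0 < t" using a K by (simp add: t_def)
  define S where "S = {x :: real^'n. subvec J x = x}"
  define T where "T x = (\<chi> k. if k \<in> J then max 0 (x $ k - t * (N *v x + z) $ k) else 0)" for x
  define q where "q = sqrt (1 - a\<^sup>2 / K\<^sup>2)"
  have aK: "a\<^sup>2 \<le> K\<^sup>2" "0 < a\<^sup>2 / K\<^sup>2"
    using a K by (auto intro: power_mono)
  then have aK1: "a\<^sup>2 / K\<^sup>2 \<le> 1" using K by (simp add: divide_le_eq)
  have q: "0 \<le> q" "q < 1" "q\<^sup>2 = 1 - a\<^sup>2 / K\<^sup>2"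
    using aK aK1 by (auto simp: q_def)
  have contr: "dist (T x) (T y) \<le> q * dist x y" if "x \<in> S" "y \<in> S" for x y
  proof -
    define e where "e = x - y"
    have eS: "subvec J e = e"
      using that by (simp add: S_def e_def subvec_linear)
    have "norm (T x - T y) \<le> norm (e - t *\<^sub>R (N *v e))"
    proof (rule norm_le_componentwise_cart)
      fix k
      have "(e - t *\<^sub>R (N *v e)) $ k
          = (x $ k - t * (N *v x + z) $ k) - (y $ k - t * (N *v y + z) $ k)"
        by (simp add: e_def algebra_simps)
      then show "norm ((T x - T y) $ k) \<le> norm ((e - t *\<^sub>R (N *v e)) $ k)"
        unfolding T_def by (simp add: max_def)
    qed
    moreover have "(norm (e - t *\<^sub>R (N *v e)))\<^sup>2 \<le> (q * norm e)\<^sup>2"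
    proof -
      have "(norm (e - t *\<^sub>R (N *v e)))\<^sup>2
          = (norm e)\<^sup>2 - 2 * t * inner (N *v e) e + t\<^sup>2 * (norm (N *v e))\<^sup>2"
        unfolding power2_norm_eq_inner
        by (simp add: inner_diff_left inner_diff_right inner_commute algebra_simps power2_eq_square)
      also have "\<dots> \<le> (norm e)\<^sup>2 - 2 * t * (a * (norm e)\<^sup>2) + t\<^sup>2 * (K * norm e)\<^sup>2"
        using N[OF eS] t KN[of e]
        by (intro add_mono diff_mono mult_left_mono power_mono) auto
      also have "\<dots> = (1 - a\<^sup>2 / K\<^sup>2) * (norm e)\<^sup>2"
        using K by (simp add: t_def field_simps power2_eq_square)
      finally show ?thesis by (simp add: power_mult_distrib q)
    qed
    ultimately show ?thesis
      by (smt (verit) dist_norm e_def mult_nonneg_nonneg norm_ge_zero power2_le_imp_le q(1))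
  qed
  have "\<exists>!x. x \<in> S \<and> T x = x"
  proof (rule Banach_fix[of S q])
    show "complete S"
      unfolding S_def complete_eq_closed by (rule closed_subvec)
    have "0 \<in> S" by (simp add: S_def)
    then show "S \<noteq> {}" by auto
    show "T ` S \<subseteq> S"
      by (auto simp: S_def T_def subvec_def vec_eq_iff)
  qed (use q contr in auto)
  moreover have "x \<in> S \<and> T x = x \<longleftrightarrow> is_lcp_solution J N z x" for x
  proof (cases "x \<in> S")
    case True
    define y where "y = N *v x + z"
    have x0: "x $ k = 0" if "k \<notin> J" for k
      using True that by (simp add: S_def subvec_eq_self_iff)
    have "T x = x \<longleftrightarrow> (\<forall>k\<in>J. x $ k = max 0 (x $ k - t * y $ k))"
      unfolding vec_eq_iff T_def y_def using x0 by auto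
    also have "\<dots> \<longleftrightarrow> (\<forall>k\<in>J. 0 \<le> x $ k \<and> 0 \<le> y $ k \<and> x $ k * y $ k = 0)"
      by (simp only: max_fixpoint_iff[OF t])
    also have "\<dots> \<longleftrightarrow> (\<forall>k\<in>J. 0 \<le> x $ k) \<and> (\<forall>k\<in>J. 0 \<le> y $ k) \<and> inner x y = 0"
    proof -
      have "inner x y = (\<Sum>k\<in>J. x $ k * y $ k)"
        unfolding inner_vec_def inner_real_def
        by (rule sum.mono_neutral_right) (auto simp: x0)
      then show ?thesis
        by (auto simp: sum_nonneg_eq_0_iff)
    qed
    finally show ?thesis
      using True by (simp add: is_lcp_solution_def S_def y_def)
  qed (auto simp: S_def is_lcp_solution_def)
  ultimately show ?thesis by simp
qed

section \<open>One coordinate of a Newton step\<close>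

text \<open>
  For \<open>m \<le> p\<close> this is the median of \<open>m\<close>, \<open>u\<close>, \<open>p\<close>.
\<close>
definition mid :: "real \<Rightarrow> real \<Rightarrow> real \<Rightarrow> real" where
  "mid m p u = max m (min u p)"

text \<open>
  What the Newton direction guarantees in one coordinate, where \<open>e\<close> stands for the
  derivative of \<open>m\<close> and \<open>p\<close> along the Newton direction. The four conjuncts belong to the modified index sets
  of active, inactive, upper kink and lower kink coordinates, in this order.
\<close>
definition newton_pair :: "real \<Rightarrow> real \<Rightarrow> real \<Rightarrow> real \<Rightarrow> real \<Rightarrow> bool" where
  "newton_pair m p u d e \<longleftrightarrow>
     (p < u \<and> 0 \<le> u \<or> u < m \<and> u \<le> 0 \<longrightarrow> mid m p u + e = 0) \<and>
     (m < u \<and> u < p \<and> m \<le> 0 \<and> 0 \<le> p \<longrightarrow> u + d = 0) \<and>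
     (u = p \<or> p < u \<and> u < 0 \<or> m < u \<and> u < p \<and> p < 0 \<longrightarrow>
        0 \<le> u + d \<and> 0 \<le> mid m p u + e \<and> (u + d = 0 \<or> mid m p u + e = 0)) \<and>
     (u = m \<or> 0 < u \<and> u < m \<or> 0 < m \<and> m < u \<and> u < p \<longrightarrow>
        u + d \<le> 0 \<and> mid m p u + e \<le> 0 \<and> (u + d = 0 \<or> mid m p u + e = 0))"

lemma mid_uminus: "m \<le> p \<Longrightarrow> mid (- p) (- m) (- u) = - mid m p u"
  by (auto simp: mid_def max_def min_def)

text \<open>
  Reflection exchanges the two kinks, so that only negative medians need to be
  treated below.
\<close>
lemma newton_pair_uminus:
  assumes "m \<le> p" "newton_pair m p u d e"
  shows "newton_pair (- p) (- m) (- u) (- d) (- e)"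
proof -
  have neg: "- a + - b = 0 \<longleftrightarrow> a + b = 0" "0 \<le> - a + - b \<longleftrightarrow> a + b \<le> 0" "- a + - b \<le> 0 \<longleftrightarrow> 0 \<le> a + b"
    for a b :: real by linarith+
  then show ?thesis
    using assms(2) unfolding newton_pair_def mid_uminus[OF assms(1)]
      neg_less_iff_less neg_equal_iff_equal neg_0_le_iff_le neg_le_0_iff_le neg_0_less_iff_less
      neg_less_0_iff_less neg by (elim conjE, intro conjI) blast+
qed

lemma mid_step_bound:
  assumes "\<bar>u' - u\<bar> \<le> r" "\<bar>p' - p\<bar> \<le> r" "p' - m' = p - m"
  shows "\<bar>mid m' p' u' - mid m p u\<bar> \<le> r"
  using assms by (auto simp: mid_def max_def min_def abs_le_iff)

text \<open>
  The core of the descent argument. A negative median is pulled towards zero at least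
  by the factor \<open>1 - s\<close>, up to the linearization error. The bound is obtained either from \<open>m'\<close> alone
  or from \<open>u + s d\<close> and \<open>p'\<close> together, because the new median is at least \<open>m'\<close> and at least the
  minimum of the other two.
  Every piece that is not controlled by a Newton relation is far from the median: nonnegative, hence
  above it by \<open>\<delta>\<close>, or separated from it by the gap \<open>\<omega>\<close>. This is why \<open>s\<close> has to be small compared with
  both.
\<close>
lemma mid_step_lower:
  fixes u p m d e s p' m' E \<delta> \<omega> :: real
  assumes pair: "newton_pair m p u d e"
    and gap: "\<omega> \<le> p - m" "0 < \<omega>" "p' - m' = p - m"
    and lin: "\<bar>p' - p - s * e\<bar> \<le> E * s\<^sup>2"
    and bounds: "\<bar>d\<bar> \<le> E" "\<bar>e\<bar> \<le> E" "\<bar>mid m p u\<bar> \<le> E"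
    and \<delta>: "mid m p u \<le> - \<delta>" "0 < \<delta>"
    and s: "0 < s" "s \<le> 1/2" "2 * E * s \<le> \<delta>" "2 * E * s \<le> \<omega>"
  shows "(1 - s) * mid m p u - E * s\<^sup>2 \<le> mid m' p' (u + s * d)"
proof -
  define f where "f = mid m p u"
  define b where "b = (1 - s) * f - E * s\<^sup>2"
  have sd: "\<bar>s * d\<bar> \<le> E * s" and se: "\<bar>s * e\<bar> \<le> E * s" and sf: "\<bar>s * f\<bar> \<le> E * s"
    using bounds s by (simp_all add: abs_mult f_def)
  have p': "p + s * e - E * s\<^sup>2 \<le> p'" and m': "m + s * e - E * s\<^sup>2 \<le> m'"
    using lin gap by (auto simp: abs_le_iff)
  have E: "0 \<le> E * s\<^sup>2" using bounds by simp
  have f: "f < 0" "E * s \<le> - ((1 - s) * f)"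
    using \<delta> s mult_mono[of "1/2" "1 - s" \<delta> "- f"] by (simp_all add: f_def)
  have via_m: "b \<le> mid m' p' (u + s * d)" if "f + e = 0" "f \<le> m"
  proof -
    have "s * e = - (s * f)" using that by (simp add: eq_neg_iff_add_eq_0 flip: distrib_left) 
    then have "b \<le> m'" using m' that by (simp add: b_def left_diff_distrib)
    then show ?thesis by (simp add: mid_def)
  qed
  have via_min: "b \<le> mid m' p' (u + s * d)"
    if "(1 - s) * f \<le> u + s * d" "(1 - s) * f \<le> p + s * e"
    using that p' E by (simp add: mid_def b_def)
  have up: "(1 - s) * f \<le> u + s * d" if "0 \<le> u + d" "f \<le> u"
    using mult_nonneg_nonneg[of s "u + d"] mult_left_mono[of f u "1 - s"] that s
    by (simp add: algebra_simps)
  have pp: "(1 - s) * f \<le> p + s * e" if "0 \<le> f + e" "f \<le> p"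
    using mult_nonneg_nonneg[of s "f + e"] that s by (simp add: algebra_simps)
  have far_u: "(1 - s) * f \<le> u + s * d" if "0 \<le> u"
    using sd f that by linarith
  have far_p: "(1 - s) * f \<le> p + s * e" if "0 \<le> p"
    using se f that by linarith
  have gap_p: "(1 - s) * f \<le> p + s * e" if "f = m"
    using se sf gap s that by (simp add: algebra_simps)
  note N = pair[unfolded newton_pair_def, folded f_def]
  have "m < p" using gap by simp
  have f_eq: "f = (if p < u then p else if u < m then m else u)"
    using \<open>m < p\<close> by (simp add: f_def mid_def)
  consider "p < u" | "u = p" | "m < u" "u < p" | "u = m" | "u < m"
    by linarith
  then have "b \<le> mid m' p' (u + s * d)"
  proof cases
    case 1
    then have "f = p" by (simp add: f_eq)
    show ?thesis
    proof (cases "0 \<le> u")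
      case True
      then have "f + e = 0" using N 1 by blast
      then show ?thesis using True \<open>f = p\<close> by (intro via_min far_u pp) auto
    next
      case False
      then have "0 \<le> u + d \<and> 0 \<le> f + e" using N 1 by auto
      then show ?thesis using 1 \<open>f = p\<close> by (intro via_min up pp) auto
    qed
  next
    case 2
    then have "f = p" using \<open>m < p\<close> by (simp add: f_eq)
    have "0 \<le> u + d \<and> 0 \<le> f + e" using N 2 by blast
    then show ?thesis using 2 \<open>f = p\<close> by (intro via_min up pp) auto
  next
    case 3
    then have "f = u" by (simp add: f_eq)
    show ?thesis
    proof (cases "0 \<le> p")
      case True
      have "m \<le> 0" using 3 \<open>f = u\<close> f(1) by linarith
      then have "u + d = 0" using N 3 True by blast
      then show ?thesis using True \<open>f = u\<close> by (intro via_min up far_p) auto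
    next
      case False
      then have "0 \<le> u + d \<and> 0 \<le> f + e" using N 3 by auto
      then show ?thesis using 3 \<open>f = u\<close> by (intro via_min up pp) auto
    qed
  next
    case 4
    then have "f = m" using \<open>m < p\<close> by (simp add: f_eq)
    have "u + d = 0 \<or> f + e = 0" using N 4 by blast
    then show ?thesis
    proof
      assume "u + d = 0"
      then show ?thesis using 4 \<open>f = m\<close> by (intro via_min up gap_p) auto
    next
      assume "f + e = 0"
      then show ?thesis using \<open>f = m\<close> by (intro via_m) auto
    qed
  next
    case 5
    then have "f = m" using \<open>m < p\<close> by (simp add: f_eq)
    then have "f + e = 0" using N 5 f(1) by auto
    then show ?thesis using \<open>f = m\<close> by (intro via_m) auto
  qed
  then show ?thesis by (simp add: b_def f_def)
qed

lemma square_step_bound: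
  fixes f f' s E :: real
  assumes "(1 - s) * f - E * s\<^sup>2 \<le> f'" "f' \<le> 0" "\<bar>f\<bar> \<le> E" "0 < s" "s \<le> 1"
  shows "f'\<^sup>2 \<le> (1 - 2 * s) * f\<^sup>2 + 4 * E\<^sup>2 * s\<^sup>2"
proof -
  have E: "0 \<le> E" using assms by linarith
  have fE: "f\<^sup>2 \<le> E\<^sup>2" using assms(3) E by (simp add: power2_le_iff_abs_le)
  have ss: "s\<^sup>2 \<le> 1" "0 \<le> s\<^sup>2" using assms by (simp_all add: power_le_one)
  have "\<bar>(1 - s) * f\<bar> \<le> 1 * E"
    unfolding abs_mult using assms by (intro mult_mono) auto
  then have "- ((1 - s) * f) \<le> E"
    by (simp add: abs_le_iff)
  then have "E * s\<^sup>2 * (- ((1 - s) * f)) \<le> E * s\<^sup>2 * E"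
    using E by (intro mult_left_mono) auto
  moreover have "s\<^sup>2 * f\<^sup>2 \<le> s\<^sup>2 * E\<^sup>2"
    using fE by (intro mult_left_mono) auto
  moreover have "E\<^sup>2 * s\<^sup>2 * s\<^sup>2 \<le> E\<^sup>2 * s\<^sup>2 * 1"
    using ss by (intro mult_left_mono) auto
  moreover have "(- f')\<^sup>2 \<le> (- ((1 - s) * f - E * s\<^sup>2))\<^sup>2"
    using assms by (intro power_mono) auto
  ultimately show ?thesis
    by (simp add: power2_eq_square algebra_simps)
qed

text \<open>
  An error of size \<open>\<epsilon> s\<close> is allowed, which makes one \<open>\<tau>\<close> serve arbitrarily small
  medians: those below a threshold \<open>\<delta>\<close> change by \<open>O(s)\<close> only and their squares by \<open>O(\<delta> s)\<close>, while
  larger ones are handled by the one-sided estimate or its reflection.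
\<close>
lemma newton_pair_square_decrease:
  fixes E \<omega> \<epsilon> :: real
  assumes E: "0 < E" and \<omega>: "0 < \<omega>" and \<epsilon>: "0 < \<epsilon>"
  obtains \<tau> where "0 < \<tau>"
    and "\<And>m p u d e s m' p'. \<lbrakk>newton_pair m p u d e; \<omega> \<le> p - m; p' - m' = p - m;
           \<bar>p' - p - s * e\<bar> \<le> E * s\<^sup>2; \<bar>d\<bar> \<le> E; \<bar>e\<bar> \<le> E; \<bar>mid m p u\<bar> \<le> E; 0 < s; s \<le> \<tau>\<rbrakk>
         \<Longrightarrow> (mid m' p' (u + s * d))\<^sup>2 \<le> (1 - 2 * s) * (mid m p u)\<^sup>2 + \<epsilon> * s"
proof -
  \<comment> \<open>medians up to \<open>\<delta>\<close> cost at most \<open>(2 \<delta>\<^sup>2 + 4 E \<delta>) s\<close>, which has to stay below half of \<open>\<epsilon> s\<close>\<close>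
  define \<delta> where "\<delta> = min 1 (\<epsilon> / (4 + 8 * E))"
  have \<delta>: "0 < \<delta>" "\<delta> \<le> 1" "(2 + 4 * E) * \<delta> \<le> \<epsilon> / 2"
  proof -
    show "0 < \<delta>" "\<delta> \<le> 1" using \<epsilon> E by (auto simp: \<delta>_def)
    have "\<delta> \<le> \<epsilon> / (4 + 8 * E)" by (simp add: \<delta>_def)
    then show "(2 + 4 * E) * \<delta> \<le> \<epsilon> / 2"
      using E by (simp add: le_divide_eq algebra_simps)
  qed
  \<comment> \<open>the first three entries are what the one-sided estimate requires, the last one absorbs the
    terms quadratic in \<open>s\<close>\<close>
  define \<tau> where "\<tau> = Min {1/2, \<delta> / (2 * E), \<omega> / (2 * E), \<epsilon> / (8 * E\<^sup>2)}"
  have \<tau>: "0 < \<tau>"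
    using assms \<delta> by (simp add: \<tau>_def)
  show thesis
  proof (rule that[OF \<tau>])
    fix m p u d e s m' p' :: real
    assume pair: "newton_pair m p u d e" and gap: "\<omega> \<le> p - m" and gap': "p' - m' = p - m"
      and lin: "\<bar>p' - p - s * e\<bar> \<le> E * s\<^sup>2"
      and bounds: "\<bar>d\<bar> \<le> E" "\<bar>e\<bar> \<le> E" "\<bar>mid m p u\<bar> \<le> E" and s: "0 < s" "s \<le> \<tau>"
    let ?f = "mid m p u" and ?f' = "mid m' p' (u + s * d)"
    have small: "s \<le> 1/2" "2 * E * s \<le> \<delta>" "2 * E * s \<le> \<omega>" "8 * E\<^sup>2 * s \<le> \<epsilon>"
      using s(2) E by (simp_all add: \<tau>_def field_simps)
    have ss: "4 * E\<^sup>2 * s\<^sup>2 \<le> \<epsilon> / 2 * s"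
      using mult_right_mono[OF small(4), of s] s(1) by (simp add: power2_eq_square)
    have step: "\<bar>?f' - ?f\<bar> \<le> 2 * E * s"
    proof (rule mid_step_bound)
      have "\<bar>s * d\<bar> \<le> E * s" "\<bar>s * e\<bar> \<le> E * s"
        using bounds s by (simp_all add: abs_mult)
      moreover have "E * s\<^sup>2 \<le> E * s"
        using E s small(1) by (simp add: power2_eq_square mult_left_le)
      ultimately show "\<bar>u + s * d - u\<bar> \<le> 2 * E * s" "\<bar>p' - p\<bar> \<le> 2 * E * s"
        using lin E s by linarith+
      show "p' - m' = p - m" by (rule gap')
    qed
    have "m < p" using gap \<omega> by linarith
    consider "\<bar>?f\<bar> \<le> \<delta>" | "?f \<le> - \<delta>" | "\<delta> \<le> ?f" by linarith
    then show "?f'\<^sup>2 \<le> (1 - 2 * s) * ?f\<^sup>2 + \<epsilon> * s"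
    proof cases
      case 1
      have "\<bar>?f'\<bar> \<le> \<bar>?f\<bar> + 2 * E * s" using step by linarith
      then have "?f'\<^sup>2 \<le> (\<bar>?f\<bar> + 2 * E * s)\<^sup>2"
        by (metis abs_ge_zero power2_abs power_mono)
      also have "\<dots> = (1 - 2 * s) * ?f\<^sup>2 + s * (2 * (\<bar>?f\<bar> * \<bar>?f\<bar>) + 4 * E * \<bar>?f\<bar>) + 4 * E\<^sup>2 * s\<^sup>2"
        by (simp add: power2_eq_square algebra_simps)
      also have "\<dots> \<le> (1 - 2 * s) * ?f\<^sup>2 + s * (2 * (\<delta> * 1) + 4 * E * \<delta>) + \<epsilon> / 2 * s"
        using 1 \<delta> s E by (intro add_mono mult_left_mono mult_mono order_refl ss) auto
      also have "\<dots> \<le> (1 - 2 * s) * ?f\<^sup>2 + s * (\<epsilon> / 2) + \<epsilon> / 2 * s"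
        using \<delta>(3) s by (intro add_mono mult_left_mono order_refl) (auto simp: algebra_simps)
      finally show ?thesis by (simp add: algebra_simps)
    next
      case 2
      have "(1 - s) * ?f - E * s\<^sup>2 \<le> ?f'"
        using pair gap \<omega> gap' lin bounds 2 \<delta>(1) s(1) small(1-3) by (rule mid_step_lower)
      moreover have "?f' \<le> 0" using step 2 small(2) by linarith
      ultimately have "?f'\<^sup>2 \<le> (1 - 2 * s) * ?f\<^sup>2 + 4 * E\<^sup>2 * s\<^sup>2"
        using bounds s small by (intro square_step_bound) auto
      with ss show ?thesis using \<epsilon> s by (smt (verit) field_sum_of_halves mult_pos_pos distrib_right)
    next
      case 3
      let ?g = "mid (- p) (- m) (- u)" and ?g' = "mid (- p') (- m') (- u + s * - d)"
      have g: "?g = - ?f" and g': "?g' = - ?f'"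
        using mid_uminus[of m p u] mid_uminus[of m' p' "u + s * d"] \<open>m < p\<close> gap' by auto
      have "(1 - s) * ?g - E * s\<^sup>2 \<le> ?g'"
      proof (rule mid_step_lower[where e = "- e" and \<delta> = \<delta> and \<omega> = \<omega>])
        show "newton_pair (- p) (- m) (- u) (- d) (- e)"
          using newton_pair_uminus pair \<open>m < p\<close> by simp
        show "\<bar>- m' - - m - s * - e\<bar> \<le> E * s\<^sup>2"
          using lin gap' by (simp add: abs_le_iff)
      qed (use gap \<omega> gap' bounds 3 \<delta>(1) s(1) small(1-3) g in auto)
      moreover have "?g' \<le> 0" using step 3 small(2) g' by linarith
      ultimately have "?g'\<^sup>2 \<le> (1 - 2 * s) * ?g\<^sup>2 + 4 * E\<^sup>2 * s\<^sup>2"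
        using bounds s small g by (intro square_step_bound) auto
      with ss show ?thesis unfolding g g' using \<epsilon> s
        by (smt (verit) field_sum_of_halves mult_pos_pos distrib_right power2_minus)
    qed
  qed
qed

section \<open>Linearization and growth bounds\<close>

lemma norm_matrix_vector_le: "norm (A *v x) \<le> norm A * norm x" for A :: "real^'n^'m"
proof -
  have "norm (A *v x) \<le> L2_set (\<lambda>i. norm (A $ i) * norm x) UNIV"
    unfolding norm_vec_def[of "A *v x"]
    by (rule L2_set_mono)
       (auto simp: matrix_vector_mul_component Cauchy_Schwarz_ineq2)
  also have "\<dots> = norm A * norm x"
    by (simp add: norm_vec_def[of A] L2_set_left_distrib)
  finally show ?thesis .
qed

lemma jacobian_linearization_bound:
  fixes f :: "real^'n \<Rightarrow> real^'m"
  assumes "\<And>x. f differentiable (at x)"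
    and L: "L-lipschitz_on UNIV (\<lambda>x. jacobian f (at x))"
  shows "norm (f (u + h) - f u - jacobian f (at u) *v h) \<le> L * (norm h)\<^sup>2"
proof -
  let ?J = "\<lambda>x. jacobian f (at x)"
  have "norm (f (u + h) - f u - ?J u *v (u + h - u)) \<le> norm (u + h - u) * (L * norm h)"
  proof (rule differentiable_bound_linearization[where S = "cball u (norm h)"])
    show "u + t *\<^sub>R (u + h - u) \<in> cball u (norm h)" if "t \<in> {0..1}" for t
      using that by (simp add: dist_norm mult_left_le_one_le)
    show "(f has_derivative (*v) (?J x)) (at x within cball u (norm h))" for x
      using assms(1) jacobian_works has_derivative_at_withinI by blast
    show "onorm ((*v) (?J x) - (*v) (?J u)) \<le> L * norm h" if "x \<in> cball u (norm h)" for x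
    proof (rule onorm_le)
      fix v
      have "norm (?J x - ?J u) \<le> L * dist x u"
        using lipschitz_onD[OF L, of x u] by (simp add: dist_norm)
      also have "\<dots> \<le> L * norm h"
        using that lipschitz_on_nonneg[OF L]
        by (intro mult_left_mono) (auto simp: dist_commute)
      finally have *: "norm (?J x - ?J u) \<le> L * norm h" .
      have "norm (((*v) (?J x) - (*v) (?J u)) v) = norm ((?J x - ?J u) *v v)"
        by (simp add: matrix_vector_mult_diff_rdistrib)
      also have "\<dots> \<le> L * norm h * norm v"
        using norm_matrix_vector_le[of "?J x - ?J u" v] mult_right_mono[OF *, of "norm v"]
        by simp
      finally show "norm (((*v) (?J x) - (*v) (?J u)) v) \<le> L * norm h * norm v" .
    qed
  qed simp
  then show ?thesis
    by (simp add: power2_eq_square mult.left_commute)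
qed

text \<open>
  Turns the energy estimate for the Newton direction into a bound of its norm.
\<close>
lemma quadratic_bound:
  fixes x a b c :: real
  assumes "0 < c" "0 \<le> a" "0 \<le> b" and x: "c * x\<^sup>2 \<le> a * x + b"
  shows "x \<le> max 1 ((a + b) / c)"
proof (cases "x \<le> 1")
  case False
  then have "c * x * x \<le> (a + b) * x"
    using x mult_left_mono[of 1 x b] assms by (simp add: power2_eq_square algebra_simps)
  then have "c * x \<le> a + b"
    using False by (simp add: mult_le_cancel_right)
  then show ?thesis
    using assms by (simp add: le_max_iff_disj pos_le_divide_eq mult.commute)
qed simp

section \<open>The piecewise linear system solved by the Newton direction\<close>

locale l1_problem =
  fixes \<gamma> c L :: real and w :: "real^'n" and g :: "real^'n \<Rightarrow> real"
  assumes \<gamma>: "0 < \<gamma>"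
    and w: "0 < w $ k"
    and coercive_hess: "coercive c (hess g u)"
    and grad_differentiable: "grad g differentiable (at u)"
    and lipschitz_hess: "L-lipschitz_on UNIV (hess g)"
begin

abbreviation "F \<equiv> resid \<gamma> w g"
abbreviation "p \<equiv> p_val \<gamma> w g"
abbreviation "m \<equiv> m_val \<gamma> w g"
abbreviation "d \<equiv> newton_dir \<gamma> w g"
abbreviation "\<Theta> \<equiv> Theta \<gamma> w g"

lemma m_less_p: "m u k < p u k"
  using mult_pos_pos[OF \<gamma> w[of k]] by (simp add: m_val_def p_val_def)

lemma resid_eq_mid: "F u $ k = mid (m u k) (p u k) (u $ k)"
  using mult_pos_pos[OF \<gamma> w[of k]]
  by (simp add: mid_def resid_def soft_threshold_def m_val_def p_val_def sgn_if max_def min_def abs_if)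

lemma A_bar_iff: "k \<in> A_bar \<gamma> w g u \<longleftrightarrow> p u k < u $ k \<and> 0 \<le> u $ k \<or> u $ k < m u k \<and> u $ k \<le> 0"
  by (auto simp: A_bar_def Ap_bar_def Am_bar_def Ap_def Am_def Ap_p_def Am_m_def)

lemma Io_bar_iff: "k \<in> Io_bar \<gamma> w g u \<longleftrightarrow> m u k < u $ k \<and> u $ k < p u k \<and> m u k \<le> 0 \<and> 0 \<le> p u k"
  by (auto simp: Io_bar_def Io_def Io_p_def Io_m_def)

lemma Ip_bar_iff: "k \<in> Ip_bar \<gamma> w g u \<longleftrightarrow>
    u $ k = p u k \<or> p u k < u $ k \<and> u $ k < 0 \<or> m u k < u $ k \<and> u $ k < p u k \<and> p u k < 0"
  by (auto simp: Ip_bar_def Ip_def Ap_p_def Io_p_def)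

lemma Im_bar_iff: "k \<in> Im_bar \<gamma> w g u \<longleftrightarrow>
    u $ k = m u k \<or> 0 < u $ k \<and> u $ k < m u k \<or> 0 < m u k \<and> m u k < u $ k \<and> u $ k < p u k"
  by (auto simp: Im_bar_def Im_def Am_m_def Io_m_def)

lemmas bar_iffs = A_bar_iff Io_bar_iff Ip_bar_iff Im_bar_iff

lemma bar_partition:
  "A_bar \<gamma> w g u \<inter> Io_bar \<gamma> w g u = {}" "A_bar \<gamma> w g u \<inter> Ip_bar \<gamma> w g u = {}"
  "A_bar \<gamma> w g u \<inter> Im_bar \<gamma> w g u = {}" "Io_bar \<gamma> w g u \<inter> Ip_bar \<gamma> w g u = {}"
  "Io_bar \<gamma> w g u \<inter> Im_bar \<gamma> w g u = {}" "Ip_bar \<gamma> w g u \<inter> Im_bar \<gamma> w g u = {}"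
  "k \<in> A_bar \<gamma> w g u \<or> k \<in> Io_bar \<gamma> w g u \<or> k \<in> Ip_bar \<gamma> w g u \<or> k \<in> Im_bar \<gamma> w g u"
proof -
  have *: "m u k < p u k" for k by (rule m_less_p)
  show "A_bar \<gamma> w g u \<inter> Io_bar \<gamma> w g u = {}" "A_bar \<gamma> w g u \<inter> Ip_bar \<gamma> w g u = {}"
    "A_bar \<gamma> w g u \<inter> Im_bar \<gamma> w g u = {}" "Io_bar \<gamma> w g u \<inter> Ip_bar \<gamma> w g u = {}"
    "Io_bar \<gamma> w g u \<inter> Im_bar \<gamma> w g u = {}" "Ip_bar \<gamma> w g u \<inter> Im_bar \<gamma> w g u = {}"
    unfolding disjoint_iff bar_iffs by (smt (verit) *)+
  show "k \<in> A_bar \<gamma> w g u \<or> k \<in> Io_bar \<gamma> w g u \<or> k \<in> Ip_bar \<gamma> w g u \<or> k \<in> Im_bar \<gamma> w g u"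
    unfolding bar_iffs by (smt (verit) *)
qed

lemma Hblock_mult_vec:
  "Hblock \<gamma> w g u P Q *v v = subvec P (schur (A_bar \<gamma> w g u) (hess g u) (subvec Q v))"
  by (simp add: Hblock_def Let_def schur_def block_mult_vec subvec_linear
      matrix_vector_mult_diff_rdistrib block_inv_subvec[OF coercive_hess]
      subvec_block_inv[OF coercive_hess] flip: matrix_vector_mul_assoc)

text \<open>
  Multiplication by \<open>+1\<close>, \<open>-1\<close> and \<open>0\<close> on the upper kinks, on the lower kinks and elsewhere. With
  it, the two-by-two block system becomes one conjugation of the Schur complement.
\<close>
definition signed :: "real^'n \<Rightarrow> real^'n \<Rightarrow> real^'n" where
  "signed u v = subvec (Ip_bar \<gamma> w g u) v - subvec (Im_bar \<gamma> w g u) v"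

lemma signed_linear:
  "signed u (v + v') = signed u v + signed u v'"
  "signed u (v - v') = signed u v - signed u v'"
  "signed u (- v) = - signed u v"
  "signed u (r *\<^sub>R v) = r *\<^sub>R signed u v"
  by (simp_all add: signed_def subvec_linear algebra_simps)

lemma lcp_N_mult_vec:
  "lcp_N \<gamma> w g u *v v = \<gamma> *\<^sub>R signed u (schur (A_bar \<gamma> w g u) (hess g u) (signed u v))"
  by (simp add: lcp_N_def Let_def signed_def Hblock_mult_vec subvec_linear schur_linear
      matrix_vector_mult_diff_rdistrib matrix_vector_mult_add_rdistrib minus_matrix_vector_mult
      algebra_simps flip: scaleR_matrix_vector_assoc)

lemma lcp_z_eq:
  "lcp_z \<gamma> w g u = signed u (F u
     - \<gamma> *\<^sub>R schur (A_bar \<gamma> w g u) (hess g u) (subvec (Io_bar \<gamma> w g u) u + signed u (signed u u))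
     - hess g u *v (block_inv (A_bar \<gamma> w g u) (hess g u) *v F u))"
  unfolding lcp_z_def Let_def lcp_N_mult_vec
  by (simp add: signed_def Hblock_mult_vec subvec_linear schur_linear
      block_mult_vec block_inv_subvec[OF coercive_hess] subvec_block_inv[OF coercive_hess]
      algebra_simps flip: matrix_vector_mul_assoc)

text \<open>
  Conjugation by \<open>signed\<close> preserves coercivity, since it changes only signs on the kink
  coordinates and these are disjoint from the active ones.
\<close>
lemma lcp_solution:
  "is_lcp_solution (Ip_bar \<gamma> w g u \<union> Im_bar \<gamma> w g u) (lcp_N \<gamma> w g u) (lcp_z \<gamma> w g u) (lcp_x \<gamma> w g u)"
proof -
  let ?A = "A_bar \<gamma> w g u" and ?P = "Ip_bar \<gamma> w g u" and ?Q = "Im_bar \<gamma> w g u"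
  let ?H = "schur ?A (hess g u)"
  have "0 < \<gamma> * c"
    using \<gamma> coercive_hess by (simp add: coercive_def)
  moreover have "\<gamma> * c * (norm v)\<^sup>2 \<le> inner (lcp_N \<gamma> w g u *v v) v" if "subvec (?P \<union> ?Q) v = v" for v
  proof -
    define y where "y = signed u v"
    have y: "y $ k = (if k \<in> ?P then v $ k else if k \<in> ?Q then - v $ k else 0)" for k
      using bar_partition(6)[of u] by (auto simp: y_def signed_def subvec_nth)
    have v: "v $ k = 0" if "k \<notin> ?P" "k \<notin> ?Q" for k
      using that \<open>subvec _ v = v\<close> by (auto simp: subvec_eq_self_iff)
    have "subvec ?A y = 0"
      using bar_partition(2,3)[of u] by (auto simp: subvec_eq_0_iff y)
    then have "c * (norm y)\<^sup>2 \<le> inner (?H y) y"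
      by (rule schur_coercive[OF coercive_hess])
    moreover have "norm y = norm v"
      by (intro antisym norm_le_componentwise_cart) (auto simp: y v)
    moreover have "inner (signed u (?H y)) v = inner (?H y) y"
      using bar_partition(6)[of u]
      by (auto simp: inner_vec_def signed_def y subvec_nth v intro!: sum.cong)
    ultimately show ?thesis
      using \<gamma> by (simp add: lcp_N_mult_vec y_def[symmetric] mult.assoc)
  qed
  ultimately show ?thesis
    unfolding lcp_x_def by (rule theI' [OF ex1_lcp_solution])
qed

text \<open>
  The linearized residual, if every coordinate is treated as active.
\<close>
definition newton_lin :: "real^'n \<Rightarrow> real^'n" where
  "newton_lin u = F u + \<gamma> *\<^sub>R (hess g u *v d u)"

lemma subvec_newton_dir_A: "subvec (A_bar \<gamma> w g u) (newton_dir_A \<gamma> w g u) = newton_dir_A \<gamma> w g u"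
  by (simp add: newton_dir_A_def Let_def subvec_linear subvec_block_inv[OF coercive_hess])

lemma newton_dir_A_eq:
  "\<gamma> *\<^sub>R newton_dir_A \<gamma> w g u = - (block_inv (A_bar \<gamma> w g u) (hess g u)
     *v (\<gamma> *\<^sub>R (hess g u *v newton_dir_I \<gamma> w g u) + F u))"
proof -
  have "subvec (I_bar \<gamma> w g u) (newton_dir_I \<gamma> w g u) = newton_dir_I \<gamma> w g u"
    by (simp add: subvec_eq_self_iff newton_dir_I_def Let_def I_bar_def subvec_nth)
  then show ?thesis
    using \<gamma> by (simp add: newton_dir_A_def Let_def block_mult_vec matrix_vector_mult_uminus
      block_inv_subvec[OF coercive_hess] algebra_simps)
qed

lemma newton_lin_eq:
  "newton_lin u = \<gamma> *\<^sub>R schur (A_bar \<gamma> w g u) (hess g u) (newton_dir_I \<gamma> w g u)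
     + F u - hess g u *v (block_inv (A_bar \<gamma> w g u) (hess g u) *v F u)"
proof -
  have "newton_lin u = F u + \<gamma> *\<^sub>R (hess g u *v newton_dir_I \<gamma> w g u)
      + hess g u *v (\<gamma> *\<^sub>R newton_dir_A \<gamma> w g u)"
    by (simp add: newton_lin_def newton_dir_def algebra_simps)
  then show ?thesis
    unfolding newton_dir_A_eq by (simp add: schur_def matrix_vector_mult_uminus algebra_simps)
qed

lemma newton_lin_A:
  assumes "k \<in> A_bar \<gamma> w g u"
  shows "newton_lin u $ k = 0"
proof -
  have "subvec (A_bar \<gamma> w g u) (newton_lin u) = 0"
    unfolding newton_lin_eq by (simp add: schur_def subvec_linear block_inv_right[OF coercive_hess])
  then show ?thesis
    using assms by (simp add: subvec_eq_0_iff)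
qed

lemma newton_step_nth:
  shows newton_step_Io: "k \<in> Io_bar \<gamma> w g u \<Longrightarrow> (u + d u) $ k = 0"
    and newton_step_Ip: "k \<in> Ip_bar \<gamma> w g u \<Longrightarrow> (u + d u) $ k = lcp_x \<gamma> w g u $ k"
    and newton_step_Im: "k \<in> Im_bar \<gamma> w g u \<Longrightarrow> (u + d u) $ k = - lcp_x \<gamma> w g u $ k"
proof -
  have "newton_dir_A \<gamma> w g u $ k = 0" if "k \<notin> A_bar \<gamma> w g u"
    using that subvec_newton_dir_A[of u] by (simp add: subvec_eq_self_iff)
  then show "k \<in> Io_bar \<gamma> w g u \<Longrightarrow> (u + d u) $ k = 0"
    "k \<in> Ip_bar \<gamma> w g u \<Longrightarrow> (u + d u) $ k = lcp_x \<gamma> w g u $ k"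
    "k \<in> Im_bar \<gamma> w g u \<Longrightarrow> (u + d u) $ k = - lcp_x \<gamma> w g u $ k"
    using bar_partition(1-6)[of u]
    by (auto simp: newton_dir_def newton_dir_I_def Let_def subvec_nth)
qed

text \<open>
  The complementarity problem is the Newton system with the active coordinates eliminated: up
  to signs, its slack variable is the linearized residual.
\<close>
lemma lcp_slack_eq: "lcp_N \<gamma> w g u *v lcp_x \<gamma> w g u + lcp_z \<gamma> w g u = signed u (newton_lin u)"
proof -
  let ?P = "Ip_bar \<gamma> w g u" and ?Q = "Im_bar \<gamma> w g u"
  have "signed u (lcp_x \<gamma> w g u) = newton_dir_I \<gamma> w g u
      + (subvec (Io_bar \<gamma> w g u) u + signed u (signed u u))"
    using bar_partition(6)[of u]
    by (auto simp: vec_eq_iff newton_dir_I_def signed_def Let_def subvec_nth)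
  then show ?thesis
    unfolding lcp_N_mult_vec lcp_z_eq newton_lin_eq
    by (simp add: signed_linear schur_linear algebra_simps)
qed

lemma newton_complementarity:
  shows newton_Ip: "k \<in> Ip_bar \<gamma> w g u \<Longrightarrow> 0 \<le> (u + d u) $ k \<and> 0 \<le> newton_lin u $ k
           \<and> ((u + d u) $ k = 0 \<or> newton_lin u $ k = 0)"
    and newton_Im: "k \<in> Im_bar \<gamma> w g u \<Longrightarrow> (u + d u) $ k \<le> 0 \<and> newton_lin u $ k \<le> 0
           \<and> ((u + d u) $ k = 0 \<or> newton_lin u $ k = 0)"
proof -
  let ?P = "Ip_bar \<gamma> w g u" and ?Q = "Im_bar \<gamma> w g u"
  define x where "x = lcp_x \<gamma> w g u"
  define y where "y = signed u (newton_lin u)"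
  have xy: "subvec (?P \<union> ?Q) x = x" "\<And>k. k \<in> ?P \<union> ?Q \<Longrightarrow> 0 \<le> x $ k"
      "\<And>k. k \<in> ?P \<union> ?Q \<Longrightarrow> 0 \<le> y $ k" "inner x y = 0"
    using lcp_solution[of u] by (simp_all add: is_lcp_solution_def lcp_slack_eq x_def y_def)
  have x0: "x $ k = 0" if "k \<notin> ?P \<union> ?Q" for k
    using xy(1) that by (auto simp: subvec_eq_self_iff)
  have nonneg: "0 \<le> x $ k * y $ k" for k
    using xy(2,3)[of k] x0[of k] by (cases "k \<in> ?P \<union> ?Q") auto
  have "(\<Sum>k\<in>UNIV. x $ k * y $ k) = 0"
    using xy(4) by (simp add: inner_vec_def)
  then have comp: "x $ k = 0 \<or> y $ k = 0" for k
    using nonneg by (simp add: sum_nonneg_eq_0_iff)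
  have y: "k \<in> ?P \<Longrightarrow> y $ k = newton_lin u $ k" "k \<in> ?Q \<Longrightarrow> y $ k = - newton_lin u $ k" for k
    using bar_partition(6)[of u] by (auto simp: y_def signed_def subvec_nth)
  show "k \<in> ?P \<Longrightarrow> 0 \<le> (u + d u) $ k \<and> 0 \<le> newton_lin u $ k
           \<and> ((u + d u) $ k = 0 \<or> newton_lin u $ k = 0)"
    using xy(2,3)[of k] comp[of k] newton_step_Ip[of k u] y(1)[of k]
    by (simp only: x_def) auto
  show "k \<in> ?Q \<Longrightarrow> (u + d u) $ k \<le> 0 \<and> newton_lin u $ k \<le> 0
           \<and> ((u + d u) $ k = 0 \<or> newton_lin u $ k = 0)"
    using xy(2,3)[of k] comp[of k] newton_step_Im[of k u] y(2)[of k]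
    by (simp only: x_def) auto
qed

section \<open>Regularity of the residual and boundedness of the Newton direction\<close>

lemma continuous_grad: "continuous_on S (grad g)"
  using grad_differentiable differentiable_imp_continuous_within
  by (metis continuous_at_imp_continuous_on)

lemma continuous_resid: "continuous_on S F"
proof -
  have "F = (\<lambda>u. \<chi> k. max (m u k) (min (u $ k) (p u k)))"
    by (simp add: fun_eq_iff vec_eq_iff resid_eq_mid mid_def)
  then show ?thesis
    unfolding m_val_def p_val_def
    by (auto intro!: continuous_intros continuous_on_max continuous_on_min continuous_grad)
qed

lemma continuous_Theta: "continuous_on S (\<Theta>)"
  unfolding Theta_def by (intro continuous_intros continuous_resid)

lemma grad_linearization:
  "norm (grad g (u + h) - grad g u - hess g u *v h) \<le> L * (norm h)\<^sup>2"
  unfolding hess_def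
  using grad_differentiable lipschitz_hess unfolding hess_def
  by (intro jacobian_linearization_bound) auto

text \<open>
  On inactive and kink coordinates \<open>u + d\<close> or the linearized residual vanishes, so \<open>d\<close> may be
  replaced by \<open>- u\<close> there; on active coordinates the linearized residual vanishes.
\<close>
lemma newton_lin_inner_d:
  "inner (newton_lin u) (d u) = - inner (newton_lin u) (subvec (- A_bar \<gamma> w g u) u)"
proof -
  have "newton_lin u $ k * d u $ k = - (newton_lin u $ k * subvec (- A_bar \<gamma> w g u) u $ k)" for k
  proof (cases "k \<in> A_bar \<gamma> w g u")
    case True
    then show ?thesis by (simp add: newton_lin_A)
  next
    case False
    then have "newton_lin u $ k * (u + d u) $ k = 0"
      using bar_partition(7)[of k u] newton_step_Io[of k u] newton_Ip[of k u] newton_Im[of k u]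
      by auto
    with False show ?thesis by (simp add: subvec_nth algebra_simps)
  qed
  then show ?thesis
    by (simp add: inner_vec_def sum_negf)
qed

text \<open>
  The energy estimate: the left side is quadratic in \<open>d\<close>, the right side affine.
\<close>
lemma d_quadratic_bound:
  "\<gamma> * (c * (norm (d u))\<^sup>2) \<le> - inner (newton_lin u) (subvec (- A_bar \<gamma> w g u) u) - inner (F u) (d u)"
proof -
  have "\<gamma> * (c * (norm (d u))\<^sup>2) \<le> \<gamma> * inner (hess g u *v d u) (d u)"
    using coercive_hess[of u] \<gamma> by (intro mult_left_mono) (auto simp: coercive_def)
  also have "\<dots> = inner (newton_lin u) (d u) - inner (F u) (d u)"
    by (simp add: newton_lin_def inner_add_left)
  finally show ?thesis by (simp add: newton_lin_inner_d)
qed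

text \<open>
  At a zero of the residual the iteration stays put, whatever step size is selected. All
  coordinates outside the active set vanish there, so that the energy estimate leaves no room for
  a nonzero direction.
\<close>
lemma d_eq_0:
  assumes "F u = 0"
  shows "d u = 0"
proof -
  have "u $ k = 0" if "k \<notin> A_bar \<gamma> w g u" for k
  proof -
    have "max (m u k) (min (u $ k) (p u k)) = 0"
      using assms resid_eq_mid[of u k] by (simp add: mid_def)
    with that m_less_p[of u k] show ?thesis
      unfolding A_bar_iff by (auto simp: max_def min_def split: if_splits)
  qed
  then have "subvec (- A_bar \<gamma> w g u) u = 0"
    by (simp add: subvec_eq_0_iff)
  then have "\<gamma> * (c * (norm (d u))\<^sup>2) \<le> 0"
    using d_quadratic_bound[of u] assms by simp
  then show ?thesis
    using \<gamma> coercive_hess[of u] by (auto simp: coercive_def mult_le_0_iff)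
qed

lemma bounds_on_cball:
  obtains E where "0 < E"
    and "\<And>u. norm u \<le> R \<Longrightarrow> norm (F u) \<le> E \<and> norm (d u) \<le> E
           \<and> norm (\<gamma> *\<^sub>R (hess g u *v d u)) \<le> E \<and> \<gamma> * L * (norm (d u))\<^sup>2 \<le> E"
proof -
  have "compact (cball (0::real^'n) R)" by simp
  then have "bounded (F ` cball 0 R)" "bounded (hess g ` cball 0 R)"
    using continuous_resid lipschitz_on_continuous_on[OF lipschitz_hess]
    by (auto intro!: compact_imp_bounded compact_continuous_image intro: continuous_on_subset)
  then obtain B K where B: "0 < B" "\<And>u. norm u \<le> R \<Longrightarrow> norm (F u) \<le> B"
      and K: "0 < K" "\<And>u. norm u \<le> R \<Longrightarrow> norm (hess g u) \<le> K"
    unfolding bounded_pos by auto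
  define D where "D = max 1 ((\<gamma> * K * \<bar>R\<bar> + B + B * \<bar>R\<bar>) / (\<gamma> * c))"
  have c: "0 < c" using coercive_hess by (simp add: coercive_def)
  have L: "0 \<le> L" using lipschitz_on_nonneg[OF lipschitz_hess] .
  have Md: "norm (\<gamma> *\<^sub>R (hess g u *v d u)) \<le> \<gamma> * K * norm (d u)" if "norm u \<le> R" for u
    using order_trans[OF norm_matrix_vector_le mult_right_mono[OF K(2)[OF that]], of "d u"] \<gamma>
    by (simp add: mult.assoc)
  have D: "norm (d u) \<le> D" if "norm u \<le> R" for u
  proof -
    let ?v = "subvec (- A_bar \<gamma> w g u) u"
    have v: "norm ?v \<le> \<bar>R\<bar>" using norm_subvec_le[of "- A_bar \<gamma> w g u" u] that by linarith
    have nl: "norm (newton_lin u) \<le> B + \<gamma> * K * norm (d u)"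
      unfolding newton_lin_def by (intro order_trans[OF norm_triangle_ineq] add_mono B(2) Md that)
    have "\<gamma> * (c * (norm (d u))\<^sup>2) \<le> norm (newton_lin u) * norm ?v + norm (F u) * norm (d u)"
      using d_quadratic_bound[of u] Cauchy_Schwarz_ineq2[of "newton_lin u" ?v]
        Cauchy_Schwarz_ineq2[of "F u" "d u"] by linarith
    also have "\<dots> \<le> (B + \<gamma> * K * norm (d u)) * \<bar>R\<bar> + B * norm (d u)"
      using B K \<gamma> that by (intro add_mono mult_mono nl v) auto
    finally have "(\<gamma> * c) * (norm (d u))\<^sup>2 \<le> (\<gamma> * K * \<bar>R\<bar> + B) * norm (d u) + B * \<bar>R\<bar>"
      by (simp add: algebra_simps)
    then show ?thesis
      unfolding D_def using c \<gamma> B K by (intro quadratic_bound) auto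
  qed
  define E where "E = Max {B, D, \<gamma> * K * D, \<gamma> * L * D\<^sup>2}"
  have E: "B \<le> E" "D \<le> E" "\<gamma> * K * D \<le> E" "\<gamma> * L * D\<^sup>2 \<le> E"
    by (simp_all add: E_def)
  show thesis
  proof (rule that)
    show "0 < E" using B E by linarith
    fix u :: "real^'n" assume u: "norm u \<le> R"
    have "\<gamma> * K * norm (d u) \<le> \<gamma> * K * D" "\<gamma> * L * (norm (d u))\<^sup>2 \<le> \<gamma> * L * D\<^sup>2"
      using D[OF u] K \<gamma> L by (auto intro!: mult_left_mono power_mono)
    then show "norm (F u) \<le> E \<and> norm (d u) \<le> E
           \<and> norm (\<gamma> *\<^sub>R (hess g u *v d u)) \<le> E \<and> \<gamma> * L * (norm (d u))\<^sup>2 \<le> E"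
      using B(2)[OF u] D[OF u] Md[OF u] E by linarith
  qed
qed

section \<open>Uniform sufficient decrease\<close>

lemma newton_pair_nth:
  "newton_pair (m u k) (p u k) (u $ k) (d u $ k) ((\<gamma> *\<^sub>R (hess g u *v d u)) $ k)"
proof -
  have lin: "mid (m u k) (p u k) (u $ k) + (\<gamma> *\<^sub>R (hess g u *v d u)) $ k = newton_lin u $ k"
    by (simp add: newton_lin_def resid_eq_mid)
  show ?thesis
    unfolding newton_pair_def lin
    using newton_lin_A[of k u] newton_step_Io[of k u] newton_Ip[of k u] newton_Im[of k u]
    unfolding bar_iffs vector_add_component by blast
qed

lemma resid_nth_decrease:
  assumes \<epsilon>: "0 < \<epsilon>"
  obtains \<tau> where "0 < \<tau>"
    and "\<And>u s. \<lbrakk>norm u \<le> R; 0 < s; s \<le> \<tau>\<rbrakk>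
         \<Longrightarrow> (F (u + s *\<^sub>R d u) $ k)\<^sup>2 \<le> (1 - 2 * s) * (F u $ k)\<^sup>2 + \<epsilon> * s"
proof -
  obtain E where E: "0 < E"
    and bd: "\<And>u. norm u \<le> R \<Longrightarrow> norm (F u) \<le> E \<and> norm (d u) \<le> E
           \<and> norm (\<gamma> *\<^sub>R (hess g u *v d u)) \<le> E \<and> \<gamma> * L * (norm (d u))\<^sup>2 \<le> E"
    by (rule bounds_on_cball [of R]) blast
  \<comment> \<open>the gap between \<open>m\<^sub>k\<close> and \<open>p\<^sub>k\<close>\<close>
  have "0 < 2 * (\<gamma> * w $ k)" using \<gamma> w by simp
  from newton_pair_square_decrease[OF E this \<epsilon>] obtain \<tau> where \<tau>: "0 < \<tau>"
    and dec: "\<And>m p u d e s m' p'. \<lbrakk>newton_pair m p u d e; 2 * (\<gamma> * w $ k) \<le> p - m; p' - m' = p - m;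
           \<bar>p' - p - s * e\<bar> \<le> E * s\<^sup>2; \<bar>d\<bar> \<le> E; \<bar>e\<bar> \<le> E; \<bar>mid m p u\<bar> \<le> E; 0 < s; s \<le> \<tau>\<rbrakk>
         \<Longrightarrow> (mid m' p' (u + s * d))\<^sup>2 \<le> (1 - 2 * s) * (mid m p u)\<^sup>2 + \<epsilon> * s"
    by blast
  show thesis
  proof (rule that[OF \<tau>])
    fix u :: "real^'n" and s
    assume u: "norm u \<le> R" and s: "0 < s" "s \<le> \<tau>"
    let ?u' = "u + s *\<^sub>R d u" and ?e = "\<gamma> *\<^sub>R (hess g u *v d u)"
    have le: "\<bar>v $ k\<bar> \<le> norm v" for v :: "real^'n" by (rule component_le_norm_cart)
    have "p ?u' k - p u k - s * ?e $ k
        = \<gamma> * (grad g ?u' - grad g u - hess g u *v (s *\<^sub>R d u)) $ k"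
      by (simp add: p_val_def matrix_vector_mult_scaleR algebra_simps)
    then have "\<bar>p ?u' k - p u k - s * ?e $ k\<bar>
        = \<gamma> * \<bar>(grad g ?u' - grad g u - hess g u *v (s *\<^sub>R d u)) $ k\<bar>"
      using \<gamma> by (simp only: abs_mult)
    also have "\<dots> \<le> \<gamma> * (L * (norm (s *\<^sub>R d u))\<^sup>2)"
      using \<gamma> by (intro mult_left_mono order_trans [OF le grad_linearization]) auto
    also have "\<dots> = \<gamma> * L * (norm (d u))\<^sup>2 * s\<^sup>2"
      by (simp add: power_mult_distrib)
    also have "\<dots> \<le> E * s\<^sup>2"
      using bd[OF u] by (intro mult_right_mono) auto
    finally have lin: "\<bar>p ?u' k - p u k - s * ?e $ k\<bar> \<le> E * s\<^sup>2" .
    have "(mid (m ?u' k) (p ?u' k) (u $ k + s * d u $ k))\<^sup>2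
        \<le> (1 - 2 * s) * (mid (m u k) (p u k) (u $ k))\<^sup>2 + \<epsilon> * s"
    proof (rule dec[OF newton_pair_nth _ _ lin _ _ _ s])
      show "2 * (\<gamma> * w $ k) \<le> p u k - m u k" "p ?u' k - m ?u' k = p u k - m u k"
        by (simp_all add: p_val_def m_val_def)
      show "\<bar>d u $ k\<bar> \<le> E" "\<bar>?e $ k\<bar> \<le> E"
        using bd[OF u] le order_trans by blast+
      show "\<bar>mid (m u k) (p u k) (u $ k)\<bar> \<le> E"
        using bd[OF u] le[of "F u"] by (simp add: resid_eq_mid)
    qed
    then show "(F ?u' $ k)\<^sup>2 \<le> (1 - 2 * s) * (F u $ k)\<^sup>2 + \<epsilon> * s"
      by (simp add: resid_eq_mid)
  qed
qed

lemma Theta_eq_sum: "\<Theta> u = (\<Sum>k\<in>UNIV. (F u $ k)\<^sup>2)"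
  by (simp add: Theta_def norm_vec_def L2_set_def sum_nonneg)

text \<open>
  Summing the coordinatewise estimates with errors \<open>\<theta> s / n\<close> costs at most \<open>\<theta> s \<le> s \<Theta>(u)\<close>. Of the
  factor \<open>1 - 2 s\<close>, this leaves \<open>1 - s\<close>, which is enough because \<open>2 \<sigma> < 1\<close>.
\<close>
lemma uniform_sufficient_decrease:
  assumes \<theta>: "0 < \<theta>" and \<sigma>: "\<sigma> < 1 / 2"
  obtains \<tau> where "0 < \<tau>" "\<tau> \<le> 1"
    and "\<And>u s. \<lbrakk>norm u \<le> R; \<theta> \<le> \<Theta> u; 0 < s; s \<le> \<tau>\<rbrakk>
         \<Longrightarrow> \<Theta> (u + s *\<^sub>R d u) \<le> (1 - 2 * \<sigma> * s) * \<Theta> u"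
proof -
  define \<epsilon> where "\<epsilon> = \<theta> / CARD('n)"
  have \<epsilon>: "0 < \<epsilon>" using \<theta> by (simp add: \<epsilon>_def)
  have "\<forall>k. \<exists>\<tau>>0. \<forall>u s. norm u \<le> R \<longrightarrow> 0 < s \<longrightarrow> s \<le> \<tau>
         \<longrightarrow> (F (u + s *\<^sub>R d u) $ k)\<^sup>2 \<le> (1 - 2 * s) * (F u $ k)\<^sup>2 + \<epsilon> * s"
    using resid_nth_decrease[OF \<epsilon>, of R] by metis
  then obtain t where t: "\<And>k. 0 < t k"
    and dec: "\<And>k u s. \<lbrakk>norm u \<le> R; 0 < s; s \<le> t k\<rbrakk>
         \<Longrightarrow> (F (u + s *\<^sub>R d u) $ k)\<^sup>2 \<le> (1 - 2 * s) * (F u $ k)\<^sup>2 + \<epsilon> * s"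
    by metis
  show thesis
  proof (rule that[of "min 1 (Min (range t))"])
    show "0 < min 1 (Min (range t))" "min 1 (Min (range t)) \<le> 1"
      using t by auto
    fix u :: "real^'n" and s
    assume u: "norm u \<le> R" and \<theta>u: "\<theta> \<le> \<Theta> u"
      and s: "0 < s" "s \<le> min 1 (Min (range t))"
    have "\<Theta> (u + s *\<^sub>R d u) \<le> (\<Sum>k\<in>UNIV. (1 - 2 * s) * (F u $ k)\<^sup>2 + \<epsilon> * s)"
      unfolding Theta_eq_sum using s by (intro sum_mono dec u) auto
    also have "\<dots> = (1 - 2 * s) * \<Theta> u + \<theta> * s"
      by (simp add: Theta_eq_sum sum.distrib sum_distrib_left \<epsilon>_def)
    also have "\<dots> \<le> (1 - 2 * s) * \<Theta> u + \<Theta> u * s"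
      using \<theta>u s by simp
    also have "\<dots> = (1 - s) * \<Theta> u"
      by (simp add: algebra_simps)
    also have "\<dots> \<le> (1 - 2 * \<sigma> * s) * \<Theta> u"
      using \<theta> \<theta>u \<sigma> s by (intro mult_right_mono) auto
    finally show "\<Theta> (u + s *\<^sub>R d u) \<le> (1 - 2 * \<sigma> * s) * \<Theta> u" .
  qed
qed

section \<open>Armijo steps and accumulation points\<close>

text \<open>
  Powers of \<open>\<beta>\<close> decrease, so the greatest admissible step is the one with the least admissible
  exponent, and it exists as soon as one exponent is admissible.
\<close>
lemma armijo_step_eq:
  fixes \<beta> \<sigma> :: real
  assumes \<beta>: "0 < \<beta>" "\<beta> < 1"
    and ex: "\<Theta> (u + \<beta> ^ l *\<^sub>R d u) \<le> (1 - 2 * \<sigma> * \<beta> ^ l) * \<Theta> u"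
  obtains n where "armijo_step \<gamma> w g \<beta> \<sigma> u = \<beta> ^ n"
    and "\<Theta> (u + \<beta> ^ n *\<^sub>R d u) \<le> (1 - 2 * \<sigma> * \<beta> ^ n) * \<Theta> u"
    and "\<And>i. i < n \<Longrightarrow> \<not> \<Theta> (u + \<beta> ^ i *\<^sub>R d u) \<le> (1 - 2 * \<sigma> * \<beta> ^ i) * \<Theta> u"
proof -
  define S where
    "S i \<longleftrightarrow> \<Theta> (u + \<beta> ^ i *\<^sub>R d u) \<le> (1 - 2 * \<sigma> * \<beta> ^ i) * \<Theta> u" for i
  define n where "n = (LEAST i. S i)"
  have n: "S n" "\<And>i. S i \<Longrightarrow> n \<le> i" "\<And>i. i < n \<Longrightarrow> \<not> S i"
    unfolding n_def using LeastI[of S l] ex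
    by (auto simp only: S_def[symmetric] intro: Least_le dest: not_less_Least)
  have "armijo_step \<gamma> w g \<beta> \<sigma> u = \<beta> ^ n"
    unfolding armijo_step_def
  proof (rule Greatest_equality)
    show "\<exists>l. \<beta> ^ n = \<beta> ^ l \<and> \<Theta> (u + \<beta> ^ l *\<^sub>R d u) \<le> (1 - 2 * \<sigma> * \<beta> ^ l) * \<Theta> u"
      using n(1) by (auto simp: S_def)
    show "y \<le> \<beta> ^ n" if "\<exists>l. y = \<beta> ^ l \<and> \<Theta> (u + \<beta> ^ l *\<^sub>R d u)
        \<le> (1 - 2 * \<sigma> * \<beta> ^ l) * \<Theta> u" for y
      using that n(2) \<beta> by (auto simp: S_def intro!: power_decreasing)
  qed
  with n show thesis
    by (intro that[of n]) (auto simp: S_def)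
qed

text \<open>
  Backtracking overshoots by at most a factor \<open>\<beta>\<close>: either the full step is accepted, or the
  step tried just before the accepted one failed and hence exceeded \<open>\<tau>\<close>.
\<close>
lemma armijo_decrease:
  fixes \<beta> \<sigma> \<tau> :: real
  assumes \<beta>: "0 < \<beta>" "\<beta> < 1" and \<sigma>: "0 < \<sigma>" and \<tau>: "0 < \<tau>" "\<tau> \<le> 1"
    and dec: "\<And>s. \<lbrakk>0 < s; s \<le> \<tau>\<rbrakk>
         \<Longrightarrow> \<Theta> (u + s *\<^sub>R d u) \<le> (1 - 2 * \<sigma> * s) * \<Theta> u"
  shows "\<Theta> (u + armijo_step \<gamma> w g \<beta> \<sigma> u *\<^sub>R d u) \<le> (1 - 2 * \<sigma> * (\<beta> * \<tau>)) * \<Theta> u"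
proof -
  obtain l where "\<beta> ^ l < \<tau>"
    using real_arch_pow_inv[OF \<tau>(1) \<beta>(2)] by blast
  then have "\<Theta> (u + \<beta> ^ l *\<^sub>R d u) \<le> (1 - 2 * \<sigma> * \<beta> ^ l) * \<Theta> u"
    using \<beta> by (intro dec) auto
  from armijo_step_eq[OF \<beta> this] obtain n where n: "armijo_step \<gamma> w g \<beta> \<sigma> u = \<beta> ^ n"
    "\<Theta> (u + \<beta> ^ n *\<^sub>R d u) \<le> (1 - 2 * \<sigma> * \<beta> ^ n) * \<Theta> u"
    "\<And>i. i < n \<Longrightarrow> \<not> \<Theta> (u + \<beta> ^ i *\<^sub>R d u) \<le> (1 - 2 * \<sigma> * \<beta> ^ i) * \<Theta> u"
    by blast
  have "\<beta> * \<tau> \<le> \<beta> ^ n"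
  proof (cases n)
    case 0
    then show ?thesis using \<beta> \<tau> by (simp add: mult_le_one)
  next
    case (Suc i)
    then have "\<not> \<beta> ^ i \<le> \<tau>" using n(3)[of i] dec[of "\<beta> ^ i"] \<beta> by auto
    then show ?thesis using Suc \<beta> by simp
  qed
  moreover have "0 \<le> \<Theta> u" by (simp add: Theta_def)
  ultimately have "(1 - 2 * \<sigma> * \<beta> ^ n) * \<Theta> u \<le> (1 - 2 * \<sigma> * (\<beta> * \<tau>)) * \<Theta> u"
    using \<sigma> by (intro mult_right_mono) auto
  with n show ?thesis by simp
qed

lemma Theta_modBSSN_decseq:
  fixes \<beta> \<sigma> :: real
  assumes \<beta>: "0 < \<beta>" "\<beta> < 1" and \<sigma>: "0 < \<sigma>" "\<sigma> < 1 / 2"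
  shows "decseq (\<lambda>j. \<Theta> (modBSSN \<gamma> w g \<beta> \<sigma> u0 j))"
proof (rule decseq_SucI)
  fix j
  define u where "u = modBSSN \<gamma> w g \<beta> \<sigma> u0 j"
  have "\<Theta> (u + armijo_step \<gamma> w g \<beta> \<sigma> u *\<^sub>R d u) \<le> \<Theta> u"
  proof (cases "F u = 0")
    case True
    then show ?thesis by (simp add: d_eq_0)
  next
    case False
    then have pos: "0 < \<Theta> u" by (simp add: Theta_def)
    from uniform_sufficient_decrease[OF pos \<sigma>(2), of "norm u"] obtain \<tau>
      where \<tau>: "0 < \<tau>" "\<tau> \<le> 1" and dec: "\<And>s. \<lbrakk>0 < s; s \<le> \<tau>\<rbrakk>
         \<Longrightarrow> \<Theta> (u + s *\<^sub>R d u) \<le> (1 - 2 * \<sigma> * s) * \<Theta> u"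
      by (metis order_refl)
    have "\<Theta> (u + armijo_step \<gamma> w g \<beta> \<sigma> u *\<^sub>R d u)
        \<le> (1 - 2 * \<sigma> * (\<beta> * \<tau>)) * \<Theta> u"
      by (rule armijo_decrease[OF \<beta> \<sigma>(1) \<tau> dec])
    also have "\<dots> \<le> 1 * \<Theta> u"
      using pos \<beta> \<sigma> \<tau> by (intro mult_right_mono) auto
    finally show ?thesis by simp
  qed
  then show "\<Theta> (modBSSN \<gamma> w g \<beta> \<sigma> u0 (Suc j)) \<le> \<Theta> (modBSSN \<gamma> w g \<beta> \<sigma> u0 j)"
    by (simp add: u_def)
qed

text \<open>
  Monotonicity transports the lower bound \<open>\<theta>\<close> from the limit to every iterate and lets one
  decrease step at \<open>r i\<close> be compared with the value at \<open>r (i + 1)\<close>.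
\<close>
lemma Theta_accumulation_point:
  fixes \<beta> \<sigma> :: real
  assumes \<beta>: "0 < \<beta>" "\<beta> < 1" and \<sigma>: "0 < \<sigma>" "\<sigma> < 1 / 2"
    and r: "strict_mono r" and lim: "(modBSSN \<gamma> w g \<beta> \<sigma> u0 \<circ> r) \<longlonglongrightarrow> ustar"
  shows "\<Theta> ustar = 0"
proof (rule ccontr)
  define x where "x = modBSSN \<gamma> w g \<beta> \<sigma> u0"
  define \<theta> where "\<theta> = \<Theta> ustar"
  assume "\<Theta> ustar \<noteq> 0"
  then have \<theta>: "0 < \<theta>" by (simp add: \<theta>_def Theta_def)
  have dec: "\<Theta> (x j) \<le> \<Theta> (x i)" if "i \<le> j" for i j
    unfolding x_def using decseqD[OF Theta_modBSSN_decseq[OF \<beta> \<sigma>] that] .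
  have lim_Theta: "(\<lambda>i. \<Theta> (x (r i))) \<longlonglongrightarrow> \<theta>"
    unfolding \<theta>_def
    using continuous_on_tendsto_compose[OF continuous_Theta[of UNIV] lim] by (simp add: x_def)
  have ge: "\<theta> \<le> \<Theta> (x (r i))" for i
    using lim_Theta r
    by (intro LIMSEQ_le_const2 exI[of _ i]) (auto intro!: dec simp: strict_mono_less_eq)
  have "bounded (range (\<lambda>i. x (r i)))"
    using lim convergent_imp_bounded[of "\<lambda>i. x (r i)"] by (simp add: x_def o_def)
  then obtain R where R: "\<And>i. norm (x (r i)) \<le> R"
    unfolding bounded_iff by auto
  from uniform_sufficient_decrease[OF \<theta> \<sigma>(2), of R] obtain \<tau> where \<tau>: "0 < \<tau>" "\<tau> \<le> 1"
    and suff: "\<And>u s. \<lbrakk>norm u \<le> R; \<theta> \<le> \<Theta> u; 0 < s; s \<le> \<tau>\<rbrakk>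
         \<Longrightarrow> \<Theta> (u + s *\<^sub>R d u) \<le> (1 - 2 * \<sigma> * s) * \<Theta> u"
    by blast
  define q where "q = 1 - 2 * \<sigma> * (\<beta> * \<tau>)"
  have q: "q < 1" using \<beta> \<sigma> \<tau> by (simp add: q_def)
  have step: "\<Theta> (x (r (Suc i))) \<le> q * \<Theta> (x (r i))" for i
  proof -
    have "\<Theta> (x (r (Suc i))) \<le> \<Theta> (x (Suc (r i)))"
      using r by (intro dec) (simp add: Suc_le_eq strict_mono_less)
    also have "\<dots> \<le> q * \<Theta> (x (r i))"
      unfolding x_def modBSSN.simps q_def
      by (intro armijo_decrease \<beta> \<sigma>(1) \<tau> suff[OF R[unfolded x_def] ge[unfolded x_def]])
    finally show ?thesis .
  qed
  have "(\<lambda>i. \<Theta> (x (r (Suc i)))) \<longlonglongrightarrow> \<theta>"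
    using LIMSEQ_Suc[OF lim_Theta] .
  moreover have "(\<lambda>i. q * \<Theta> (x (r i))) \<longlonglongrightarrow> q * \<theta>"
    by (intro tendsto_intros lim_Theta)
  ultimately have "\<theta> \<le> q * \<theta>"
    using step by (intro LIMSEQ_le) auto
  with \<theta> q show False by simp
qed

end

theorem theorem12:
  fixes g :: "real^'n \<Rightarrow> real" and w u0 ustar :: "real^'n" and \<gamma> \<beta> \<sigma> c1 c2 :: real
  assumes "strictly_convex_on UNIV g"
    and "\<forall>k. 0 < w $ k"
    and "0 < \<gamma>"
    and "\<forall>u. g differentiable (at u)"
    and "\<forall>u. grad g differentiable (at u)"
    and "\<exists>L. L-lipschitz_on UNIV (hess g)"
    and "\<forall>u h. h \<noteq> 0 \<longrightarrow> 0 < inner (hess g u *v h) h"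
    and "0 < c1" and "0 < c2"
    and "\<forall>u h. c1 * (norm h)\<^sup>2 \<le> inner (hess g u *v h) h \<and>
                inner (hess g u *v h) h \<le> c2 * (norm h)\<^sup>2"
    and "\<forall>v. compact {u. Theta \<gamma> w g u \<le> Theta \<gamma> w g v}"
    and "0 < \<beta>" and "\<beta> < 1"
    and "0 < \<sigma>" and "\<sigma> < 1 / 2"
    and "\<exists>r. strict_mono r \<and> (modBSSN \<gamma> w g \<beta> \<sigma> u0 \<circ> r) \<longlonglongrightarrow> ustar"
  shows "Theta \<gamma> w g ustar = 0"
proof -
  obtain L where "L-lipschitz_on UNIV (hess g)" using assms(6) by blast
  then interpret l1_problem \<gamma> c1 L w g
    using assms by unfold_locales (auto simp: coercive_def)
  show ?thesis
    using assms Theta_accumulation_point by blast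
qed

end
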